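(* There is an absolute constant $C>0$ such that the following holds. Let $x_1,\dots,x_n\in\mathbb{R}^d$, let $\gamma>0$, and let each $l_j:\mathbb{R}\to\mathbb{R}$ be a convex quadratic loss (e.g. $l_j(z)=\frac12(z-y_j)^2$), so that the Hessian of $F(w)=\frac1n\sum_{j=1}^n l_j(x_j^Tw)+\frac{\gamma}{2}\|w\|_2^2$ is a constant matrix $H=\frac1nA^TA+\gamma I_d$, where $A\in\mathbb{R}^{n\times d}$ has $j$-th row $\sqrt{l_j''}\,x_j^T$. Let $d_{\mathrm{eff}}^\gamma$ and $\mu^\gamma$ be the $\gamma$-effective dimension and row $\gamma$-ridge coherence of $A$, let $\kappa=\sigma_{\max}(H)/\sigma_{\min}(H)$, and let $w^\star$ be the unique minimizer of $F$. Let the $n$ samples be partitioned uniformly at random among $m$ worker machines, each receiving $s=n/m$ samples. Let $\varepsilon\in(0,\frac14)$, $\delta\in(0,1)$, and suppose $$ s\ \ge\ C\,\frac{\mu^\gamma d_{\mathrm{eff}}^\gamma}{\varepsilon}\log\frac{m\,d_{\mathrm{eff}}^\gamma}{\delta}. $$ Let $w_0\in\mathbb{R}^d$ and let $(w_t)_{t\ge0}$ be the GIANT iterates with unit step size, $w_{t+1}=w_t-\frac1m\sum_{i=1}^m\widetilde H_i^{-1}\nabla F(w_t)$, where $\widetilde H_i=\frac1sA_i^TA_i+\gamma I_d$ and $A_i\in\mathbb{R}^{s\times d}$ consists of the rows of $A$ assigned to worker $i$. Then, with probability at least $1-\delta$ over the random partition, for all $t\ge0$, $$ \|w_t-w^\star\|_2\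 \le\ \varepsilon^t\sqrt\kappa\,\|w_0-w^\star\|_2 . $$
   Context: For $A=[a_1^T;\dots;a_n^T]\in\mathbb{R}^{n\times d}$ and $\gamma\ge0$, the row $\gamma$-ridge leverage scores are $l_j^\gamma=a_j^T(A^TA+n\gamma I_d)^\dagger a_j$, $j=1,\dots,n$. The $\gamma$-effective dimension is $d_{\mathrm{eff}}^\gamma(A)=\sum_{j=1}^n l_j^\gamma=\sum_{k=1}^d\frac{\sigma_k^2}{\sigma_k^2+n\gamma}$, where $\sigma_1,\dots,\sigma_d$ are the singular values of $A$. The row $\gamma$-ridge coherence is $\mu^\gamma(A)=\frac{n}{d_{\mathrm{eff}}^\gamma}\max_{i}l_i^\gamma$. It is assumed that $m$ divides $n$. $\sigma_{\max},\sigma_{\min}$ denote largest and smallest singular values.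
   Formalization: When the effective dimension is below 1, the sample condition also requires s ≥ C μ d_eff/ε (the logarithm is read as at least 1); without this the claim fails for every C, since log(m d_eff/δ) may be negative, as for d=1, n=m=2. *)

theory Defs
  imports
    "HOL-Probability.Probability"
    "Jordan_Normal_Form.Gauss_Jordan_Elimination"
    "Jordan_Normal_Form.DL_Submatrix"
    "Jordan_Normal_Form.Char_Poly"
begin

(* The constant C of the theorem is absolute, so the dimension d is quantified inside "EX C".
   It therefore has to be a natural number, and R^d is rendered as carrier_vec d rather than as
   the type real^'d.  The clashing HOL-Analysis notations are switched off. *)

unbundle no vec_syntax and no inner_syntax
hide_type (open) Finite_Cartesian_Product.vec
hide_const (open) Finite_Cartesian_Product.vec Finite_Cartesian_Product.mat
  Finite_Cartesian_Product.row

definition vnorm :: "real vec \<Rightarrow> real" where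
  "vnorm v = sqrt (v \<bullet> v)"

(* Moore-Penrose pseudoinverse of a real matrix, by the four Penrose equations. *)
definition pseudoinverse :: "real mat \<Rightarrow> real mat" where
  "pseudoinverse M = (THE X. X \<in> carrier_mat (dim_col M) (dim_row M)
      \<and> M * X * M = M \<and> X * M * X = X
      \<and> transpose_mat (M * X) = M * X \<and> transpose_mat (X * M) = X * M)"

(* A matrix with c columns gets c singular values (as a set, without multiplicities). *)
definition singular_values :: "real mat \<Rightarrow> real set" where
  "singular_values M = {sqrt k | k. eigenvalue (transpose_mat M * M) k}"

definition sigma_max :: "real mat \<Rightarrow> real" where
  "sigma_max M = Max (singular_values M)"

definition sigma_min :: "real mat \<Rightarrow> real" where
  "sigma_min M = Min (singular_values M)"

(* Rows are numbered from 0; n is dim_row A. *)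
definition ridge_leverage :: "real mat \<Rightarrow> real \<Rightarrow> nat \<Rightarrow> real" where
  "ridge_leverage A \<gamma> j = row A j \<bullet>
     (pseudoinverse (transpose_mat A * A + (real (dim_row A) * \<gamma>) \<cdot>\<^sub>m 1\<^sub>m (dim_col A)) *\<^sub>v row A j)"

definition effective_dim :: "real mat \<Rightarrow> real \<Rightarrow> real" where
  "effective_dim A \<gamma> = (\<Sum>j<dim_row A. ridge_leverage A \<gamma> j)"

(* For A = 0 the effective dimension is 0, and the coherence is then 0 as well. *)
definition ridge_coherence :: "real mat \<Rightarrow> real \<Rightarrow> real" where
  "ridge_coherence A \<gamma> =
     real (dim_row A) / effective_dim A \<gamma> * Max (ridge_leverage A \<gamma> ` {..<dim_row A})"

(* (1/r) M^T M + gamma I, where r is the number of rows of M: the matrix H when M = A,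
   the local matrix of worker i when M = A_i. *)
definition regularized_gram :: "real mat \<Rightarrow> real \<Rightarrow> real mat" where
  "regularized_gram M \<gamma> =
     (1 / real (dim_row M)) \<cdot>\<^sub>m (transpose_mat M * M) + \<gamma> \<cdot>\<^sub>m 1\<^sub>m (dim_col M)"

(* Affine losses (a = 0) are allowed. *)
definition convex_quadratic :: "(real \<Rightarrow> real) \<Rightarrow> bool" where
  "convex_quadratic f \<longleftrightarrow> convex_on UNIV f \<and> (\<exists>a b c. \<forall>z. f z = a * z\<^sup>2 + b * z + c)"

definition objective ::
  "nat \<Rightarrow> (nat \<Rightarrow> real vec) \<Rightarrow> (nat \<Rightarrow> real \<Rightarrow> real) \<Rightarrow> real \<Rightarrow> real vec \<Rightarrow> real" where
  "objective n x l \<gamma> w = (1 / real n) * (\<Sum>j<n. l j (x j \<bullet> w)) + \<gamma> / 2 * (vnorm w)\<^sup>2"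

(* The second derivative of a quadratic loss is constant, so it is read off at 0. *)
definition data_matrix ::
  "nat \<Rightarrow> nat \<Rightarrow> (nat \<Rightarrow> real vec) \<Rightarrow> (nat \<Rightarrow> real \<Rightarrow> real) \<Rightarrow> real mat" where
  "data_matrix n d x l = mat n d (\<lambda>(j, k). sqrt (deriv (deriv (l j)) 0) * x j $ k)"

definition gradient :: "nat \<Rightarrow> (real vec \<Rightarrow> real) \<Rightarrow> real vec \<Rightarrow> real vec" where
  "gradient d f w = vec d (\<lambda>k. deriv (\<lambda>t. f (w + t \<cdot>\<^sub>v unit_vec d k)) 0)"

(* p j is the worker that receives sample j. *)
definition balanced_assignments :: "nat \<Rightarrow> nat \<Rightarrow> (nat \<Rightarrow> nat) set" where
  "balanced_assignments n m =
     {p \<in> {..<n} \<rightarrow>\<^sub>E {..<m}. \<forall>i<m. card {j. j < n \<and> p j = i} = n div m}"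

definition worker_matrix :: "real mat \<Rightarrow> (nat \<Rightarrow> nat) \<Rightarrow> nat \<Rightarrow> real mat" where
  "worker_matrix A p i = submatrix A {j. p j = i} UNIV"

primrec giant_iterate ::
  "nat \<Rightarrow> nat \<Rightarrow> (real vec \<Rightarrow> real) \<Rightarrow> real mat \<Rightarrow> real \<Rightarrow> (nat \<Rightarrow> nat) \<Rightarrow> real vec \<Rightarrow> nat \<Rightarrow> real vec"
where
  "giant_iterate d m F A \<gamma> p w0 0 = w0"
| "giant_iterate d m F A \<gamma> p w0 (Suc t) =
     giant_iterate d m F A \<gamma> p w0 t -
     (1 / real m) \<cdot>\<^sub>v finsum_vec TYPE(real) d
       (\<lambda>i. the (mat_inverse (regularized_gram (worker_matrix A p i) \<gamma>))
              *\<^sub>v gradient d F (giant_iterate d m F A \<gamma> p w0 t)) {..<m}"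

end

theory Submission
  imports Defs
begin

text \<open>
  Let \<open>e\<close> be the error of an iterate and \<open>H\<^sub>i\<close> the matrix of worker \<open>i\<close>. The workers partition the samples,
  so the \<open>H\<^sub>i\<close> average to \<open>H\<close>, and if every \<open>H\<^sub>i\<close> is within relative distance \<open>\<eta>\<close> of \<open>H\<close>, then the averaged
  Newton step contracts \<open>e\<close> in the norm of \<open>H\<close> by \<open>\<eta>\<^sup>2 / (1 - \<eta>)\<close>. With \<open>\<eta>\<^sup>2 = \<epsilon> / 2\<close> this is at most \<open>\<epsilon>\<close>, and
  \<open>\<kappa>\<close> compares the norm of \<open>H\<close> with the Euclidean one.

  The closeness is a matrix concentration inequality for sampling without replacement, proved with
  exchangeable pairs. Let \<open>X\<close> be \<open>s\<close> times the deviation \<open>H\<^sub>i - H\<close> in \<open>H\<close>-orthonormal coordinates, let \<open>X'\<close> arise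
  from \<open>X\<close> by exchanging a sample of the worker with one of another worker, and let \<open>R = \<mu> d\<close> where \<open>d\<close> is
  the effective dimension. Averaging over the exchanges, \<open>X - X'\<close> is proportional to \<open>X\<close>, so
  \<open>E tr X\<^sup>2\<^sup>q\<close> is a multiple of \<open>E tr (X - X') (X\<^sup>2\<^sup>q\<^sup>-\<^sup>1 - X'\<^sup>2\<^sup>q\<^sup>-\<^sup>1)\<close>, which a mean value inequality for traces
  bounds by \<open>q\<close> times \<open>E tr (X - X')\<^sup>2 X\<^sup>2\<^sup>q\<^sup>-\<^sup>2\<close>. The rows have squared norm at most \<open>R\<close>, and hence
  \<open>E tr X\<^sup>2\<^sup>q\<close> is at most \<open>20 R q s\<close> times \<open>E tr X\<^sup>2\<^sup>q\<^sup>-\<^sup>2\<close>, down to \<open>E tr X\<^sup>2 \<le> 4 R s d\<close>. Markov's inequality with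
  \<open>q\<close> of order \<open>log (m d / \<delta>)\<close> and a union bound over the workers finish the argument.
\<close>

subsection \<open>Frobenius inner product and powers of symmetric matrices\<close>

text \<open>The trace of \<open>transpose_mat P * Q\<close>, written out over the entries. Traces of
  matrix powers appear below as inner products of this kind.\<close>

definition frob :: "real mat \<Rightarrow> real mat \<Rightarrow> real" where
  "frob P Q = (\<Sum>i<dim_row P. \<Sum>j<dim_col P. P $$ (i, j) * Q $$ (i, j))"

lemma frob_carrier:
  "P \<in> carrier_mat r c \<Longrightarrow> frob P Q = (\<Sum>i<r. \<Sum>j<c. P $$ (i, j) * Q $$ (i, j))"
  unfolding frob_def by auto

lemma frob_self_nonneg: "0 \<le> frob P P"
  unfolding frob_def by (intro sum_nonneg) auto

lemma frob_amgm:
  assumes "P \<in> carrier_mat r c" "Q \<in> carrier_mat r c"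
  shows "2 * frob P Q \<le> frob P P + frob Q Q"
proof -
  have "2 * frob P Q = (\<Sum>i<r. \<Sum>j<c. 2 * (P $$ (i, j) * Q $$ (i, j)))"
    using assms by (simp add: frob_carrier sum_distrib_left)
  also have "\<dots> \<le> (\<Sum>i<r. \<Sum>j<c. P $$ (i, j) * P $$ (i, j) + Q $$ (i, j) * Q $$ (i, j))"
  proof (intro sum_mono)
    fix i j
    show "2 * (P $$ (i, j) * Q $$ (i, j)) \<le> P $$ (i, j) * P $$ (i, j) + Q $$ (i, j) * Q $$ (i, j)"
      using sum_squares_bound[of "P $$ (i, j)" "Q $$ (i, j)"] by (simp add: power2_eq_square)
  qed
  also have "\<dots> = frob P P + frob Q Q"
    using assms by (simp add: frob_carrier sum.distrib)
  finally show ?thesis .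
qed

text \<open>AM-GM for \<open>x \<cdot>\<^sub>m P\<close> and \<open>Q\<close>. The scalar may be
  negative: in \<open>T_Suc_le_T\<close> the coefficient of the mixed term has no fixed
  sign.\<close>

lemma frob_young:
  assumes "P \<in> carrier_mat r c" "Q \<in> carrier_mat r c"
  shows "x * frob P Q \<le> (x\<^sup>2 * frob P P + frob Q Q) / 2"
proof -
  have "frob (x \<cdot>\<^sub>m P) Q = x * frob P Q" "frob (x \<cdot>\<^sub>m P) (x \<cdot>\<^sub>m P) = x\<^sup>2 * frob P P"
    using assms by (simp_all add: frob_carrier[of _ r c] sum_distrib_left power2_eq_square mult_ac)
  then show ?thesis using frob_amgm[of "x \<cdot>\<^sub>m P" r c Q] assms by simp
qed

lemma frob_diff_right:
  assumes "P \<in> carrier_mat r c" "Q \<in> carrier_mat r c" "Q' \<in> carrier_mat r c"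
  shows "frob P (Q - Q') = frob P Q - frob P Q'"
  using assms by (simp add: frob_carrier right_diff_distrib sum_subtractf)

lemma frob_add_right:
  assumes "P \<in> carrier_mat r c" "Q \<in> carrier_mat r c" "Q' \<in> carrier_mat r c"
  shows "frob P (Q + Q') = frob P Q + frob P Q'"
  using assms by (simp add: frob_carrier distrib_left sum.distrib)

lemma index_mult_mat_sum:
  assumes "A \<in> carrier_mat r k" "B \<in> carrier_mat k c" "i < r" "j < c"
  shows "(A * B) $$ (i, j) = (\<Sum>l<k. A $$ (i, l) * B $$ (l, j))"
  using assms by (auto simp: scalar_prod_def atLeast0LessThan intro!: sum.cong)

text \<open>Multiplication by a matrix has multiplication by its transpose as adjoint. Together with
  \<open>frob_mult_right\<close> this takes the place of cyclicity of the trace.\<close>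

lemma frob_mult_left:
  assumes A: "A \<in> carrier_mat r k" and P: "P \<in> carrier_mat k c" and Q: "Q \<in> carrier_mat r c"
  shows "frob (A * P) Q = frob P (transpose_mat A * Q)"
proof -
  have "frob (A * P) Q = (\<Sum>i<r. \<Sum>j<c. \<Sum>l<k. A $$ (i, l) * P $$ (l, j) * Q $$ (i, j))"
    using assms by (simp add: frob_carrier[of _ r c] index_mult_mat_sum sum_distrib_right
      del: index_mult_mat)
  also have "\<dots> = (\<Sum>l<k. \<Sum>j<c. \<Sum>i<r. A $$ (i, l) * P $$ (l, j) * Q $$ (i, j))"
    by (subst sum.swap, subst (2) sum.swap, subst sum.swap) simp
  also have "\<dots> = (\<Sum>l<k. \<Sum>j<c. P $$ (l, j) * (transpose_mat A * Q) $$ (l, j))"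
    using assms by (intro sum.cong refl)
      (auto simp: index_mult_mat_sum[of _ k r _ c] sum_distrib_left ac_simps simp del: index_mult_mat
        intro!: sum.cong)
  finally show ?thesis using P by (simp add: frob_carrier)
qed

lemma frob_transpose:
  assumes "P \<in> carrier_mat r c" "Q \<in> carrier_mat r c"
  shows "frob (transpose_mat P) (transpose_mat Q) = frob P Q"
  using assms by (subst (1 2) frob_carrier, auto) (subst sum.swap, simp)

lemma frob_mult_right:
  assumes B: "B \<in> carrier_mat k c" and P: "P \<in> carrier_mat r k" and Q: "Q \<in> carrier_mat r c"
  shows "frob (P * B) Q = frob P (Q * transpose_mat B)"
proof -
  have "frob (P * B) Q = frob (transpose_mat B * transpose_mat P) (transpose_mat Q)"
    using assms by (metis frob_transpose mult_carrier_mat transpose_mult)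
  also have "\<dots> = frob (transpose_mat P) (B * transpose_mat Q)"
    using assms by (subst frob_mult_left[of _ c k _ r]) auto
  also have "\<dots> = frob P (Q * transpose_mat B)"
    using assms frob_transpose[of P r k "Q * transpose_mat B"] by (simp add: transpose_mult[of Q r c])
  finally show ?thesis .
qed

section \<open>Powers of symmetric matrices\<close>

declare minus_carrier_mat [simp]

lemma mult_carrier_square [simp]:
  "A \<in> carrier_mat d d \<Longrightarrow> B \<in> carrier_mat d d \<Longrightarrow> A * B \<in> carrier_mat d d"
  by (rule mult_carrier_mat)

definition symmetric_mat :: "nat \<Rightarrow> real mat \<Rightarrow> bool" where
  "symmetric_mat d A \<longleftrightarrow> A \<in> carrier_mat d d \<and> transpose_mat A = A"

lemma symmetric_matD: "symmetric_mat d A \<Longrightarrow> A \<in> carrier_mat d d"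
  "symmetric_mat d A \<Longrightarrow> transpose_mat A = A"
  unfolding symmetric_mat_def by auto

lemma pow_mat_add:
  fixes A :: "'a :: semiring_1 mat"
  assumes "A \<in> carrier_mat d d"
  shows "A ^\<^sub>m (a + b) = A ^\<^sub>m a * A ^\<^sub>m b"
proof (induction b)
  case (Suc b)
  then show ?case using assms by (simp add: assoc_mult_mat[of _ d d _ d _ d])
qed (use assms in simp)

lemma symmetric_pow:
  assumes "symmetric_mat d A" shows "symmetric_mat d (A ^\<^sub>m k)"
proof (induction k)
  case (Suc k)
  have A: "A \<in> carrier_mat d d" "transpose_mat A = A"
    using assms by (auto dest: symmetric_matD)
  have "A ^\<^sub>m Suc k = A * A ^\<^sub>m k"
    using pow_mat_add[OF A(1), of 1 k] A by simp
  then have "transpose_mat (A ^\<^sub>m Suc k) = A ^\<^sub>m Suc k"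
    using A Suc by (simp add: symmetric_mat_def transpose_mult[of _ d d _ d])
  then show ?case using A by (simp add: symmetric_mat_def)
qed (use symmetric_matD[OF assms] in \<open>simp add: symmetric_mat_def\<close>)

text \<open>Symmetric factors pass to the other argument, so only the total exponent on each side
  matters. Read from right to left, a mixed term is an inner product for every splitting of its
  exponents, which is what AM-GM needs.\<close>

lemma frob_sandwich:
  assumes A: "symmetric_mat d A" and B: "symmetric_mat d B" and C: "C \<in> carrier_mat d d"
  shows "frob (A ^\<^sub>m a * C * B ^\<^sub>m b) (A ^\<^sub>m a' * C * B ^\<^sub>m b')
    = frob C (A ^\<^sub>m (a + a') * C * B ^\<^sub>m (b' + b))"
proof -
  note [simp] = symmetric_matD[OF A] symmetric_matD[OF B] symmetric_matD[OF symmetric_pow[OF A]]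
   symmetric_matD[OF symmetric_pow[OF B]] C pow_mat_add[of _ d]
  have "frob (A ^\<^sub>m a * C * B ^\<^sub>m b) (A ^\<^sub>m a' * C * B ^\<^sub>m b')
      = frob (A ^\<^sub>m a * C) (A ^\<^sub>m a' * C * B ^\<^sub>m b' * B ^\<^sub>m b)"
    by (subst frob_mult_right[of _ d d _ d]) (auto simp: assoc_mult_mat[of _ d d _ d _ d])
  also have "\<dots> = frob C (A ^\<^sub>m a * (A ^\<^sub>m a' * C * B ^\<^sub>m b' * B ^\<^sub>m b))"
    by (subst frob_mult_left[of _ d d _ d]) auto
  finally show ?thesis by (simp add: assoc_mult_mat[of _ d d _ d _ d])
qed

text \<open>Telescoping without commutativity. \<open>Z\<close> is generalised because the induction
  moves the trailing \<open>B\<close> of each summand onto it.\<close>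

lemma frob_power_diff:
  assumes A: "A \<in> carrier_mat d d" and B: "B \<in> carrier_mat d d" and "Z \<in> carrier_mat d d"
  shows "frob Z (A ^\<^sub>m q - B ^\<^sub>m q) = (\<Sum>k<q. frob Z (A ^\<^sub>m k * (A - B) * B ^\<^sub>m (q - 1 - k)))"
  using assms(3)
proof (induction q arbitrary: Z)
  case 0
  then show ?case using A B by (simp add: frob_carrier)
next
  case (Suc q)
  note [simp] = A B Suc.prems
  have ZB[simp]: "Z * transpose_mat B \<in> carrier_mat d d"
    by (rule mult_carrier_mat[of _ d d]) (use A B in auto)
  have *: "frob Z (Y * B) = frob (Z * transpose_mat B) Y" if "Y \<in> carrier_mat d d" for Y
    using frob_mult_right[of "transpose_mat B" d d Z d Y] that by simp
  have "A ^\<^sub>m Suc q - B ^\<^sub>m Suc q = (A ^\<^sub>m q - B ^\<^sub>m q) * B + A ^\<^sub>m q * (A - B)"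
  proof -
    define P where "P = A ^\<^sub>m q"
    have [simp]: "P \<in> carrier_mat d d" "P * A \<in> carrier_mat d d" "P * B \<in> carrier_mat d d"
       "B ^\<^sub>m q * B \<in> carrier_mat d d" unfolding P_def by simp_all
    have *: "dim_row P = d" "dim_col P = d" "dim_row A = d" "dim_col A = d" "dim_row B = d" "dim_col B = d"
       "dim_row (B ^\<^sub>m q) = d" using carrier_matD[OF A] carrier_matD[OF B] by (simp_all add: P_def)
    have "(P - B ^\<^sub>m q) * B + P * (A - B) = (P * B - B ^\<^sub>m q * B) + (P * A - P * B)"
      by (simp add: minus_mult_distrib_mat[of _ d d _ _ d] mult_minus_distrib_mat[of _ d d _ d])
    also have "\<dots> = P * A - B ^\<^sub>m q * B"
      by (intro eq_matI) (simp_all del: index_mult_mat(1) add: *)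
    finally show ?thesis unfolding P_def by simp
  qed
  then have "frob Z (A ^\<^sub>m Suc q - B ^\<^sub>m Suc q)
      = frob (Z * transpose_mat B) (A ^\<^sub>m q - B ^\<^sub>m q) + frob Z (A ^\<^sub>m q * (A - B))"
    by (simp add: frob_add_right[of _ d d] * del: pow_mat.simps)
  also have "frob (Z * transpose_mat B) (A ^\<^sub>m q - B ^\<^sub>m q)
      = (\<Sum>k<q. frob Z (A ^\<^sub>m k * (A - B) * B ^\<^sub>m (q - k)))"
    unfolding Suc.IH[OF ZB]
  proof (intro sum.cong refl)
    fix k assume "k \<in> {..<q}"
    then have "q - k = Suc (q - 1 - k)" by auto
    then show "frob (Z * transpose_mat B) (A ^\<^sub>m k * (A - B) * B ^\<^sub>m (q - 1 - k)) =
      frob Z (A ^\<^sub>m k * (A - B) * B ^\<^sub>m (q - k))"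
      by (subst *[symmetric]) (auto simp: assoc_mult_mat[of _ d d _ d _ d])
  qed
  also have "frob Z (A ^\<^sub>m q * (A - B)) = frob Z (A ^\<^sub>m q * (A - B) * B ^\<^sub>m (q - q))"
    using carrier_matD[OF B] by (simp add: right_mult_one_mat[of _ d d])
  finally show ?case by simp
qed

text \<open>At the leftmost maximum, if it is interior, the left neighbour is strictly smaller, so
  convexity would push the right neighbour above the maximum.\<close>

lemma discrete_convex_le_max:
  fixes g :: "nat \<Rightarrow> real"
  assumes "\<And>a. 0 < a \<Longrightarrow> a < h \<Longrightarrow> 2 * g a \<le> g (a - 1) + g (a + 1)" and "a \<le> h"
  shows "g a \<le> max (g 0) (g h)"
proof (rule ccontr)
  assume neg: "\<not> ?thesis"
  define M where "M = Max (g ` {..h})"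
  have M: "g b \<le> M" if "b \<le> h" for b unfolding M_def using that by auto
  have "M \<in> g ` {..h}" unfolding M_def by (intro Max_in) auto
  then have "\<exists>b. b \<le> h \<and> g b = M" by auto
  define b where "b = (LEAST b. b \<le> h \<and> g b = M)"
  have b: "b \<le> h" "g b = M" using LeastI_ex[OF \<open>\<exists>b. b \<le> h \<and> g b = M\<close>] unfolding b_def by auto
  have "b \<noteq> 0" "b \<noteq> h" using neg M[OF \<open>a \<le> h\<close>] b by (metis le_max_iff_disj)+
  then have b': "0 < b" "b < h" using b by auto
  have "g (b - 1) \<noteq> M" using not_less_Least[of "b - 1" "\<lambda>b. b \<le> h \<and> g b = M"] b' unfolding b_def[symmetric] by auto
  then have "g (b - 1) < M" using M[of "b - 1"] b' by (intro order.not_eq_order_implies_strict) auto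
  then show False using assms(1)[OF b'] M[of "b + 1"] b b' by auto
qed

text \<open>By AM-GM, \<open>k \<mapsto> frob C (A\<^sup>k C B\<^sup>2\<^sup>h\<^sup>-\<^sup>k)\<close> is midpoint convex, so its values lie below those at the
  ends; this stands in for the spectral proof of a Heinz inequality.\<close>

lemma frob_sandwich_le:
  assumes A: "symmetric_mat d A" and B: "symmetric_mat d B" and C: "C \<in> carrier_mat d d"
    and kl: "k + l = 2 * h"
  shows "frob C (A ^\<^sub>m k * C * B ^\<^sub>m l) \<le> frob (A ^\<^sub>m h * C) (A ^\<^sub>m h * C) + frob (C * B ^\<^sub>m h) (C * B ^\<^sub>m h)"
proof -
  note [simp] = symmetric_matD[OF A] symmetric_matD[OF B] C
  define f where "f a b = frob C (A ^\<^sub>m a * C * B ^\<^sub>m b)" for a b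
  have f2: "f (a + a') (b' + b) = frob (A ^\<^sub>m a * C * B ^\<^sub>m b) (A ^\<^sub>m a' * C * B ^\<^sub>m b')" for a a' b b'
    using frob_sandwich[OF A B C] unfolding f_def by simp
  have am: "2 * f (a + a') (b' + b) \<le> f (a + a) (b + b) + f (a' + a') (b' + b')" for a a' b b'
    unfolding f2 by (intro frob_amgm[of _ d d]) auto
  have nn: "0 \<le> f (a + a) (b + b)" for a b unfolding f2 by (rule frob_self_nonneg)
  \<comment> \<open>At even exponents \<open>f\<close> is a squared norm, hence nonnegative, and
    \<open>am\<close> for neighbouring splittings makes \<open>g\<close> midpoint convex.\<close>
  define g where "g a = f (a + a) ((h - a) + (h - a))" for a
  have g0: "g 0 = frob (C * B ^\<^sub>m h) (C * B ^\<^sub>m h)" "g h = frob (A ^\<^sub>m h * C) (A ^\<^sub>m h * C)"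
    unfolding g_def f2 using carrier_matD[OF symmetric_matD(1)[OF A]] carrier_matD[OF symmetric_matD(1)[OF B]]
    by (simp_all add: left_mult_one_mat[of _ d d] right_mult_one_mat[of _ d d])
  have "2 * g a \<le> g (a - 1) + g (a + 1)" if "0 < a" "a < h" for a
  proof -
    have "a - 1 + (a + 1) = a + a" "h - (a + 1) + (h - (a - 1)) = h - a + (h - a)" using that by auto
    then show ?thesis using am[of "a - 1" "a + 1" "h - (a + 1)" "h - (a - 1)"] unfolding g_def
      by simp
  qed
  then have g: "g a \<le> g 0 + g h" if "a \<le> h" for a
    using discrete_convex_le_max[of h g a] that nn unfolding g_def
    by (smt (verit, best))
  have "f k l \<le> g 0 + g h"
  proof (cases "even k")
    case True
    then obtain a where a: "k = a + a" by (metis evenE mult_2)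
    then have "l = (h - a) + (h - a)" "a \<le> h" using kl by auto
    then show ?thesis using g[of a] a unfolding g_def by simp
  next
    \<comment> \<open>An odd exponent lies midway between two even ones, and AM-GM bounds its term
      by their average.\<close>
    case False
    then obtain a where a: "k = a + (a + 1)" by (metis oddE mult_2 add.assoc)
    then have l: "l = (h - (a + 1)) + (h - a)" "a + 1 \<le> h" using kl by auto
    then have "2 * f k l \<le> g a + g (a + 1)" using am[of a "a + 1" "h - (a + 1)" "h - a"] a
      unfolding g_def by simp
    then show ?thesis using g[of a] g[of "a + 1"] l by auto
  qed
  then show ?thesis unfolding f_def g0 by simp
qed

text \<open>A mean value inequality for traces. Each of the \<open>2 * h + 1\<close> terms of the
  telescoped difference carries total exponent \<open>2 * h\<close>, and
  \<open>frob_sandwich_le\<close> bounds all of them by the same pair of end terms.\<close>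

lemma frob_diff_pow_le:
  assumes A: "symmetric_mat d A" and B: "symmetric_mat d B"
  shows "frob (A - B) (A ^\<^sub>m (2 * h + 1) - B ^\<^sub>m (2 * h + 1)) \<le>
     real (2 * h + 1) * (frob (A ^\<^sub>m h * (A - B)) (A ^\<^sub>m h * (A - B)) + frob (B ^\<^sub>m h * (A - B)) (B ^\<^sub>m h * (A - B)))"
proof -
  note [simp] = symmetric_matD[OF A] symmetric_matD[OF B] symmetric_matD[OF symmetric_pow[OF B]]
  have C [simp]: "A - B \<in> carrier_mat d d" by (intro minus_carrier_mat) simp
  \<comment> \<open>Transposing moves the power of \<open>B\<close> to the left, so that both end
    terms have the shape estimated in \<open>frob_mult_C_le\<close>.\<close>
  have "transpose_mat (B ^\<^sub>m h * (A - B)) = (A - B) * B ^\<^sub>m h"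
    by (subst transpose_mult[of _ d d _ d]) (auto simp: transpose_minus[of _ d d])
  then have eq: "frob ((A - B) * B ^\<^sub>m h) ((A - B) * B ^\<^sub>m h) = frob (B ^\<^sub>m h * (A - B)) (B ^\<^sub>m h * (A - B))"
    using frob_transpose[of "B ^\<^sub>m h * (A - B)" d d "B ^\<^sub>m h * (A - B)"]
      mult_carrier_mat[of "B ^\<^sub>m h" d d "A - B" d] by (simp add: C)
  have "frob (A - B) (A ^\<^sub>m (2 * h + 1) - B ^\<^sub>m (2 * h + 1)) =
    (\<Sum>k<2 * h + 1. frob (A - B) (A ^\<^sub>m k * (A - B) * B ^\<^sub>m (2 * h + 1 - 1 - k)))"
    by (rule frob_power_diff[of _ d]) auto
  also have "\<dots> \<le> (\<Sum>k<2 * h + 1. frob (A ^\<^sub>m h * (A - B)) (A ^\<^sub>m h * (A - B))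
      + frob ((A - B) * B ^\<^sub>m h) ((A - B) * B ^\<^sub>m h))"
    by (intro sum_mono frob_sandwich_le[OF A B C]) auto
  finally show ?thesis unfolding eq by (simp add: algebra_simps)
qed

subsection \<open>Weighted Gram matrices\<close>

text \<open>The sum of the outer squares of the \<open>u j\<close> with weights \<open>w j\<close>.
  The weights may be negative: \<open>X\<close> and \<open>C\<close> below are both of this
  kind.\<close>

definition wgram :: "nat \<Rightarrow> nat \<Rightarrow> (nat \<Rightarrow> real vec) \<Rightarrow> (nat \<Rightarrow> real) \<Rightarrow> real mat" where
  "wgram D n u w = mat D D (\<lambda>(a, b). \<Sum>j<n. w j * (u j $ a * u j $ b))"

lemma wgram_carrier [simp]: "wgram D n u w \<in> carrier_mat D D"
  unfolding wgram_def by simp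

lemma symmetric_wgram: "symmetric_mat D (wgram D n u w)"
  unfolding symmetric_mat_def wgram_def by (auto intro!: eq_matI sum.cong)

lemma scalar_prod_sum: "w \<in> carrier_vec D \<Longrightarrow> v \<bullet> w = (\<Sum>a<D. v $ a * w $ a)"
  unfolding scalar_prod_def by (auto simp: atLeast0LessThan)

lemma scalar_prod_self_nonneg: "v \<in> carrier_vec D \<Longrightarrow> 0 \<le> v \<bullet> (v :: real vec)"
  by (simp add: scalar_prod_sum[of _ D] sum_nonneg)

lemma scalar_prod_Cauchy_Schwarz:
  assumes "v \<in> carrier_vec D" "w \<in> carrier_vec D"
  shows "(v \<bullet> w)\<^sup>2 \<le> (v \<bullet> v) * (w \<bullet> (w :: real vec))"
  using Cauchy_Schwarz_ineq_sum[of "\<lambda>a. v $ a" "\<lambda>a. w $ a" "{..<D}"] assms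
  by (simp add: scalar_prod_sum[of _ D] power2_eq_square)

lemma scalar_prod_self_eq_0: "(v :: real vec) \<in> carrier_vec d \<Longrightarrow> v \<bullet> v = 0 \<longleftrightarrow> v = 0\<^sub>v d"
  by (auto simp: scalar_prod_sum[of _ d] sum_nonneg_eq_0_iff intro!: eq_vecI)

lemma scalar_prod_le_squares:
  assumes "v \<in> carrier_vec d" "w \<in> carrier_vec d"
  shows "2 * (v \<bullet> w) \<le> v \<bullet> v + w \<bullet> (w :: real vec)"
proof -
  have "2 * (x * y) \<le> x * x + y * y" for x y :: real
    using sum_squares_bound[of x y] by (simp add: power2_eq_square)
  then have "(\<Sum>a<d. 2 * (v $ a * w $ a)) \<le> (\<Sum>a<d. v $ a * v $ a + w $ a * w $ a)"
    by (intro sum_mono)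
  then show ?thesis using assms by (simp add: scalar_prod_sum[of _ d] sum.distrib sum_distrib_left)
qed

lemma mult_mat_vec_sum:
  "Y \<in> carrier_mat r c \<Longrightarrow> v \<in> carrier_vec c \<Longrightarrow> a < r \<Longrightarrow> (Y *\<^sub>v v) $ a = (\<Sum>b<c. Y $$ (a, b) * v $ b)"
  by (auto simp: scalar_prod_sum[of v c])

text \<open>The Frobenius norm dominates the operator norm, by Cauchy-Schwarz on each row. This
  yields operator bounds without eigenvalues.\<close>

lemma norm_mult_mat_vec_le:
  assumes Y: "Y \<in> carrier_mat r c" and v: "v \<in> carrier_vec c"
  shows "(Y *\<^sub>v v) \<bullet> (Y *\<^sub>v v) \<le> frob Y Y * (v \<bullet> v)"
proof -
  have Yv: "Y *\<^sub>v v \<in> carrier_vec r" using assms by simp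
  have "(Y *\<^sub>v v) \<bullet> (Y *\<^sub>v v) = (\<Sum>a<r. (row Y a \<bullet> v)\<^sup>2)"
    using Y by (simp add: scalar_prod_sum[OF Yv] power2_eq_square)
  also have "\<dots> \<le> (\<Sum>a<r. (row Y a \<bullet> row Y a) * (v \<bullet> v))"
    using assms by (intro sum_mono scalar_prod_Cauchy_Schwarz) auto
  also have "\<dots> = frob Y Y * (v \<bullet> v)"
    using Y by (simp add: frob_carrier scalar_prod_sum[of "row Y _" c] sum_distrib_right)
  finally show ?thesis .
qed

lemma quadratic_form_sum:
  fixes Y :: "real mat"
  assumes "Y \<in> carrier_mat D D" "v \<in> carrier_vec D" "w \<in> carrier_vec D"
  shows "v \<bullet> (Y *\<^sub>v w) = (\<Sum>a<D. \<Sum>b<D. v $ a * w $ b * Y $$ (a, b))"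
proof -
  have "v \<bullet> (Y *\<^sub>v w) = (\<Sum>a<D. v $ a * (\<Sum>b<D. Y $$ (a, b) * w $ b))"
    using assms by (subst scalar_prod_sum[of _ D]) (auto simp: mult_mat_vec_sum[of Y D D] simp del: index_mult_mat_vec)
  also have "\<dots> = (\<Sum>a<D. \<Sum>b<D. v $ a * w $ b * Y $$ (a, b))"
    unfolding sum_distrib_left by (intro sum.cong refl) simp
  finally show ?thesis .
qed

lemma frob_wgram:
  assumes Y: "Y \<in> carrier_mat D D" and u: "\<And>j. j < n \<Longrightarrow> u j \<in> carrier_vec D"
  shows "frob (wgram D n u w) Y = (\<Sum>j<n. w j * (u j \<bullet> (Y *\<^sub>v u j)))"
proof -
  have "frob (wgram D n u w) Y = (\<Sum>a<D. \<Sum>b<D. \<Sum>j<n. w j * (u j $ a * u j $ b * Y $$ (a, b)))"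
    unfolding frob_carrier[OF wgram_carrier]
    by (intro sum.cong refl) (simp add: wgram_def sum_distrib_right mult.assoc)
  also have "\<dots> = (\<Sum>j<n. \<Sum>a<D. \<Sum>b<D. w j * (u j $ a * u j $ b * Y $$ (a, b)))"
    by (subst (2) sum.swap, subst sum.swap) simp
  also have "\<dots> = (\<Sum>j<n. w j * (u j \<bullet> (Y *\<^sub>v u j)))"
    using u Y by (intro sum.cong refl) (simp add: quadratic_form_sum sum_distrib_left)
  finally show ?thesis .
qed

lemma wgram_form:
  assumes u: "\<And>j. j < n \<Longrightarrow> u j \<in> carrier_vec D" and v: "v \<in> carrier_vec D" and w: "w \<in> carrier_vec D"
  shows "v \<bullet> (wgram D n u c *\<^sub>v w) = (\<Sum>j<n. c j * ((u j \<bullet> v) * (u j \<bullet> w)))"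
proof -
  have "v \<bullet> (wgram D n u c *\<^sub>v w) = (\<Sum>a<D. \<Sum>b<D. \<Sum>j<n. c j * ((u j $ a * v $ a) * (u j $ b * w $ b)))"
    unfolding quadratic_form_sum[OF wgram_carrier v w]
    by (intro sum.cong refl) (simp add: wgram_def sum_distrib_left mult_ac)
  also have "\<dots> = (\<Sum>j<n. \<Sum>a<D. \<Sum>b<D. c j * ((u j $ a * v $ a) * (u j $ b * w $ b)))"
    by (subst (2) sum.swap, subst sum.swap) simp
  also have "\<dots> = (\<Sum>j<n. c j * ((u j \<bullet> v) * (u j \<bullet> w)))"
    by (simp only: scalar_prod_sum[OF v] scalar_prod_sum[OF w] sum_product) (simp only: sum_distrib_left)
  finally show ?thesis .
qed

lemma symmetric_scalar_prod:
  assumes "symmetric_mat d A" "v \<in> carrier_vec d" "w \<in> carrier_vec d"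
  shows "v \<bullet> (A *\<^sub>v w) = (A *\<^sub>v v) \<bullet> w"
  using transpose_vec_mult_scalar[of A d d w v] symmetric_matD[OF assms(1)] assms
  by (auto simp: comm_scalar_prod[of _ d])

lemma quadratic_form_even_power:
  assumes "symmetric_mat d A" "v \<in> carrier_vec d"
  shows "v \<bullet> (A ^\<^sub>m (2 * h) *\<^sub>v v) = (A ^\<^sub>m h *\<^sub>v v) \<bullet> (A ^\<^sub>m h *\<^sub>v v)"
proof -
  have c: "A ^\<^sub>m h \<in> carrier_mat d d" "A \<in> carrier_mat d d" using assms by (auto dest: symmetric_matD)
  have "A ^\<^sub>m (2 * h) = A ^\<^sub>m h * A ^\<^sub>m h" using pow_mat_add[OF c(2), of h h] by (simp add: mult_2)
  then show ?thesis
    using symmetric_scalar_prod[OF symmetric_pow[OF assms(1)], of v "A ^\<^sub>m h *\<^sub>v v" h] c assms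
    by (simp add: assoc_mult_mat_vec[of _ d d _ d])
qed

subsection \<open>Balanced assignments\<close>

lemma balanced_assignments_swap:
  assumes p: "p \<in> balanced_assignments n m" and j: "j < n" and k: "k < n"
  shows "p \<circ> Transposition.transpose j k \<in> balanced_assignments n m"
proof -
  let ?t = "Transposition.transpose j k"
  have t: "?t x < n \<longleftrightarrow> x < n" for x using j k by (auto simp: Transposition.transpose_def)
  have "p \<circ> ?t \<in> {..<n} \<rightarrow>\<^sub>E {..<m}"
  proof
    fix x assume "x \<in> {..<n}"
    then show "(p \<circ> ?t) x \<in> {..<m}" using p t[of x] unfolding balanced_assignments_def by auto
  next
    \<comment> \<open>Beyond \<open>n\<close> the exchange fixes \<open>x\<close>, so the default
      value \<open>undefined\<close> is preserved.\<close>
    fix x assume "x \<notin> {..<n}"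
    moreover from this have "?t x = x" using j k by (auto simp: Transposition.transpose_def)
    moreover have "p \<in> {..<n} \<rightarrow>\<^sub>E {..<m}" using p unfolding balanced_assignments_def by blast
    ultimately show "(p \<circ> ?t) x = undefined" using PiE_arb[of p "{..<n}" "\<lambda>_. {..<m}" x] by simp
  qed
  moreover have "card {x. x < n \<and> (p \<circ> ?t) x = i} = card {x. x < n \<and> p x = i}" for i
  proof (rule bij_betw_same_card[of ?t], rule bij_betw_byWitness[where f' = ?t])
  qed (auto simp: t)
  ultimately show ?thesis using p unfolding balanced_assignments_def by auto
qed

lemma card_residue_class: "i < m \<Longrightarrow> card {j. j < m * s \<and> j mod m = i} = (s :: nat)"
proof -
  assume i: "i < m"
  have "{j. j < m * s \<and> j mod m = i} = (\<lambda>k. i + m * k) ` {..<s}"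
  proof safe
    fix j assume j: "j < m * s" "i = j mod m"
    then have "j div m < s" by (metis less_mult_imp_div_less mult.commute)
    then show "j \<in> (\<lambda>k. j mod m + m * k) ` {..<s}" by (intro image_eqI[of _ _ "j div m"]) auto
  next
    fix k assume "k < s"
    then have "m * (k + 1) \<le> m * s" by (intro mult_le_mono) auto
    then show "i + m * k < m * s" using i by simp
  qed (use i in simp)
  moreover have "inj_on (\<lambda>k. i + m * k) {..<s}" using i by (auto simp: inj_on_def)
  ultimately show ?thesis by (simp add: card_image)
qed

lemma balanced_assignments_nonempty:
  assumes "0 < m" "m dvd n"
  shows "balanced_assignments n m \<noteq> {}"
proof -
  obtain s where n: "n = m * s" using \<open>m dvd n\<close> by blast
  \<comment> \<open>Dealing the samples out in rotation gives every worker one residue class modulo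
    \<open>m\<close>.\<close>
  define p where "p = restrict (\<lambda>j. j mod m) {..<n}"
  have "{j. j < n \<and> p j = i} = {j. j < m * s \<and> j mod m = i}" for i unfolding p_def n by auto
  then have "p \<in> balanced_assignments n m"
    unfolding balanced_assignments_def using \<open>0 < m\<close> card_residue_class[of _ m s] unfolding n
    by (auto simp: p_def n)
  then show ?thesis by blast
qed

locale balanced_sampling =
  fixes n m s i :: nat
  assumes n_eq: "n = m * s" and s_pos: "0 < s" and i_less: "i < m"
begin

abbreviation "\<B> \<equiv> balanced_assignments n m"

lemma n_pos: "0 < n" and s_le_n: "s \<le> n"
  using n_eq s_pos i_less by auto

lemma n_div_m: "n div m = s" using n_eq i_less by auto

lemma finite_B: "finite \<B>"
  unfolding balanced_assignments_def by (rule finite_subset[of _ "{..<n} \<rightarrow>\<^sub>E {..<m}"]) (auto intro: finite_PiE)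

definition picked :: "(nat \<Rightarrow> nat) \<Rightarrow> nat set" where "picked p = {j. j < n \<and> p j = i}"
definition unpicked :: "(nat \<Rightarrow> nat) \<Rightarrow> nat set" where "unpicked p = {j. j < n \<and> p j \<noteq> i}"
text \<open>The indicator that worker \<open>i\<close> holds sample \<open>j\<close>, minus
  \<open>s / n = 1 / m\<close>, its mean under a uniform balanced assignment.\<close>

definition chi :: "(nat \<Rightarrow> nat) \<Rightarrow> nat \<Rightarrow> real" where "chi p j = of_bool (p j = i) - real s / real n"

lemma finite_picked [simp]: "finite (picked p)" "finite (unpicked p)"
  unfolding picked_def unpicked_def by auto

lemma card_picked: "p \<in> \<B> \<Longrightarrow> card (picked p) = s"
  using i_less n_div_m unfolding balanced_assignments_def picked_def by auto

lemma picked_Un: "{..<n} = picked p \<union> unpicked p" "picked p \<inter> unpicked p = {}"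
  unfolding picked_def unpicked_def by auto

lemma card_unpicked: "p \<in> \<B> \<Longrightarrow> real (card (unpicked p)) = real n - real s"
proof -
  assume p: "p \<in> \<B>"
  have "n = card (picked p \<union> unpicked p)" unfolding picked_Un(1)[of p, symmetric] by simp
  also have "\<dots> = s + card (unpicked p)"
    using card_Un_disjoint[of "picked p" "unpicked p"] picked_Un(2)[of p] card_picked[OF p] by simp
  finally show ?thesis by simp
qed

lemma sum_split: "(\<Sum>j<n. f j) = sum f (picked p) + (sum f (unpicked p) :: real)"
proof -
  have "(\<Sum>j<n. f j) = sum f (picked p \<union> unpicked p)" unfolding picked_Un(1)[of p, symmetric] ..
  then show ?thesis using sum.union_disjoint[of "picked p" "unpicked p" f] picked_Un(2)[of p] by simp
qed

lemma sum_chi: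
  "(\<Sum>j<n. chi p j * f j) = sum f (picked p) - real s / real n * (\<Sum>j<n. f j)"
proof -
  have "(\<Sum>j<n. chi p j * f j) = (\<Sum>j<n. of_bool (p j = i) * f j) - real s / real n * (\<Sum>j<n. f j)"
    unfolding chi_def by (simp add: left_diff_distrib sum_subtractf sum_distrib_left)
  also have "(\<Sum>j<n. of_bool (p j = i) * f j) = sum f (picked p)"
    unfolding picked_def by (intro sum.mono_neutral_cong_right) auto
  finally show ?thesis .
qed

text \<open>Summing the change over all exchanges returns \<open>n\<close> times the centred
  statistic. This is the linear regression property of the exchangeable pair: on average
  \<open>X - X'\<close> is proportional to \<open>X\<close>.\<close>

lemma sum_pairs_diff:
  assumes "p \<in> \<B>"
  shows "(\<Sum>j\<in>picked p. \<Sum>k\<in>unpicked p. f j - f k) = real n * (\<Sum>j<n. chi p j * f j)"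
proof -
  have "(\<Sum>j\<in>picked p. \<Sum>k\<in>unpicked p. f j - f k)
     = (real n - real s) * sum f (picked p) - real s * sum f (unpicked p)"
    by (simp add: sum_subtractf card_unpicked[OF assms] card_picked[OF assms] sum_distrib_left)
  also have "sum f (unpicked p) = (\<Sum>j<n. f j) - sum f (picked p)" using sum_split[of f p] by simp
  moreover have "real n * (real s / real n * (\<Sum>j<n. f j)) = real s * (\<Sum>j<n. f j)" using n_pos by simp
  ultimately show ?thesis unfolding sum_chi by (simp add: algebra_simps)
qed

text \<open>The same count for sums serves the conditional variance. It splits into a fluctuation
  with coefficient \<open>n - 2 * s\<close> and a full sum over all samples.\<close>

lemma sum_pairs_add:
  assumes "p \<in> \<B>"
  shows "(\<Sum>j\<in>picked p. \<Sum>k\<in>unpicked p. f j + f k) =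
    (real n - 2 * real s) * (\<Sum>j<n. chi p j * f j) + 2 * real s * (real n - real s) / real n * (\<Sum>j<n. f j)"
proof -
  have "(\<Sum>j\<in>picked p. \<Sum>k\<in>unpicked p. f j + f k)
     = (real n - real s) * sum f (picked p) + real s * sum f (unpicked p)"
    by (simp add: sum.distrib card_unpicked[OF assms] card_picked[OF assms] sum_distrib_left)
  also have "sum f (unpicked p) = (\<Sum>j<n. f j) - sum f (picked p)" using sum_split[of f p] by simp
  finally have *: "(\<Sum>j\<in>picked p. \<Sum>k\<in>unpicked p. f j + f k) =
    (real n - real s) * sum f (picked p) + real s * ((\<Sum>j<n. f j) - sum f (picked p))" .
  define r where "r = real s / real n"
  have r: "real s = r * real n" using n_pos unfolding r_def by simp
  have "2 * real s * (real n - real s) / real n = 2 * r * (real n - real s)" unfolding r_def by simp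
  then show ?thesis unfolding sum_chi * r_def[symmetric] unfolding r by (simp only:) (simp add: algebra_simps)
qed

text \<open>Exchanging the workers of \<open>j\<close> and \<open>k\<close> is an involution on the triples \<open>(p, j, k)\<close>: this is the
  exchangeable pair.\<close>

lemma sum_swap:
  fixes \<phi> :: "(nat \<Rightarrow> nat) \<Rightarrow> nat \<Rightarrow> nat \<Rightarrow> real"
  shows "(\<Sum>p\<in>\<B>. \<Sum>j\<in>picked p. \<Sum>k\<in>unpicked p. \<phi> p j k) =
    (\<Sum>p\<in>\<B>. \<Sum>j\<in>picked p. \<Sum>k\<in>unpicked p. \<phi> (p \<circ> Transposition.transpose j k) k j)"
proof -
  have *: "(\<Sum>p\<in>\<B>. \<Sum>j\<in>picked p. \<Sum>k\<in>unpicked p. \<phi> p j k) =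
     (\<Sum>(p, j, k)\<in>Sigma \<B> (\<lambda>p. picked p \<times> unpicked p). \<phi> p j k)" for \<phi> :: "(nat \<Rightarrow> nat) \<Rightarrow> nat \<Rightarrow> nat \<Rightarrow> real"
    using finite_B by (simp add: sum.Sigma sum.cartesian_product)
  have swap2 [simp]: "p \<circ> Transposition.transpose j k \<circ> Transposition.transpose k j = p" for p :: "nat \<Rightarrow> nat" and j k
    by (rule ext) (simp add: transpose_commute[of k j])
  define T where "T = Sigma \<B> (\<lambda>p. picked p \<times> unpicked p)"
  define f :: "(nat \<Rightarrow> nat) \<times> nat \<times> nat \<Rightarrow> (nat \<Rightarrow> nat) \<times> nat \<times> nat"
    where "f = (\<lambda>(p, j, k). (p \<circ> Transposition.transpose j k, k, j))"
  have ff: "f (f x) = x" for x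
    by (cases x) (simp add: f_def)
  have fT: "f x \<in> T" if "x \<in> T" for x
    using that balanced_assignments_swap unfolding T_def f_def by (auto simp: picked_def unpicked_def)
  have "bij_betw f T T"
    by (rule bij_betw_byWitness[where f' = f]) (use ff fT in blast)+
  from sum.reindex_bij_betw[OF this, of "\<lambda>(p, j, k). \<phi> p j k"]
  show ?thesis unfolding * T_def[symmetric] by (simp add: f_def case_prod_unfold)
qed

end

text \<open>Both sides are the trace of the same power, so exponents can be shifted between the
  arguments.\<close>

lemma frob_pow:
  assumes A: "symmetric_mat d A"
  shows "frob (A ^\<^sub>m a) (A ^\<^sub>m b) = frob (1\<^sub>m d) (A ^\<^sub>m (a + b))"
proof (induction a arbitrary: b)
  case 0
  then show ?case using carrier_matD[OF symmetric_matD(1)[OF A]] by simp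
next
  case (Suc a)
  note [simp] = symmetric_matD[OF A]
  have "frob (A ^\<^sub>m Suc a) (A ^\<^sub>m b) = frob (A ^\<^sub>m a) (A ^\<^sub>m Suc b)"
    by (simp add: frob_mult_right[of _ d d _ d])
  then show ?case using Suc[of "Suc b"] by simp
qed

subsection \<open>Moments of the sampling error\<close>

lemma sum_unit_diff:
  fixes f :: "nat \<Rightarrow> real"
  assumes "j < n" "k < n"
  shows "(\<Sum>x<n. (of_bool (x = j) - of_bool (x = k)) * f x) = f j - f k"
  using assms by (simp add: left_diff_distrib sum_subtractf sum.delta of_bool_def if_distrib[of "\<lambda>z. z * _"] cong: if_cong)

text \<open>In the application \<open>u j\<close> is the \<open>j\<close>-th row of the data matrix in coordinates that turn \<open>H\<close> into the
  identity, \<open>e\<close> is the effective dimension, and \<open>X p\<close> below is \<open>s\<close> times the deviation of the matrix of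
  worker \<open>i\<close> from \<open>H\<close>.\<close>

locale frame_sampling = balanced_sampling +
  fixes D :: nat and u :: "nat \<Rightarrow> real vec" and R e :: real
  assumes u_carrier: "\<And>j. j < n \<Longrightarrow> u j \<in> carrier_vec D"
    and u_le: "\<And>j. j < n \<Longrightarrow> u j \<bullet> u j \<le> R"
    and frame: "\<And>y. y \<in> carrier_vec D \<Longrightarrow> (\<Sum>j<n. (u j \<bullet> y)\<^sup>2) \<le> real n * (y \<bullet> y)"
    and trace: "(\<Sum>j<n. u j \<bullet> u j) = real n * e"
begin

definition X :: "(nat \<Rightarrow> nat) \<Rightarrow> real mat" where "X p = wgram D n u (chi p)"

text \<open>The outer square of \<open>u j\<close> minus that of \<open>u k\<close>: the amount by
  which \<open>X\<close> drops when worker \<open>i\<close> trades sample \<open>j\<close> for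
  sample \<open>k\<close>.\<close>

definition C :: "nat \<Rightarrow> nat \<Rightarrow> real mat" where
  "C j k = wgram D n u (\<lambda>x. of_bool (x = j) - of_bool (x = k))"

definition sqnorm :: "(nat \<Rightarrow> nat) \<Rightarrow> nat \<Rightarrow> nat \<Rightarrow> real" where
  "sqnorm p h j = (X p ^\<^sub>m h *\<^sub>v u j) \<bullet> (X p ^\<^sub>m h *\<^sub>v u j)"

lemma X_sym: "symmetric_mat D (X p)"
  unfolding X_def by (rule symmetric_wgram)

lemma C_sym: "symmetric_mat D (C j k)"
  unfolding C_def by (rule symmetric_wgram)

lemmas X_carrier [simp] = symmetric_matD(1)[OF X_sym]
lemmas C_carrier [simp] = symmetric_matD(1)[OF C_sym]

lemma R_nonneg: "0 \<le> R"
proof -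
  have "0 \<le> u 0 \<bullet> u 0" using scalar_prod_self_nonneg[OF u_carrier[OF n_pos]] .
  then show ?thesis using u_le[OF n_pos] by simp
qed

lemma frob_C:
  assumes "j < n" "k < n" "Y \<in> carrier_mat D D"
  shows "frob (C j k) Y = u j \<bullet> (Y *\<^sub>v u j) - u k \<bullet> (Y *\<^sub>v u k)"
  unfolding C_def using assms u_carrier by (simp add: frob_wgram sum_unit_diff)

lemma frob_X:
  assumes "Y \<in> carrier_mat D D"
  shows "frob (X p) Y = (\<Sum>j<n. chi p j * (u j \<bullet> (Y *\<^sub>v u j)))"
  unfolding X_def using assms u_carrier by (simp add: frob_wgram)

lemma X_swap:
  assumes "j \<in> picked p" "k \<in> unpicked p"
  shows "X p - X (p \<circ> Transposition.transpose j k) = C j k"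
proof -
  have "chi p x - chi (p \<circ> Transposition.transpose j k) x = of_bool (x = j) - of_bool (x = k)" for x
    using assms unfolding chi_def picked_def unpicked_def by (auto simp: Transposition.transpose_def)
  then show ?thesis unfolding X_def C_def wgram_def
    by (auto simp flip: sum_subtractf left_diff_distrib intro!: eq_matI)
qed

text \<open>\<open>P * C j k\<close> is a difference of two outer products, whose squared Frobenius
  norms are products of squared vector norms; \<open>R\<close> bounds the factors that come from
  \<open>u\<close>.\<close>

lemma frob_mult_C_le:
  assumes P: "P \<in> carrier_mat D D" and j: "j < n" and k: "k < n"
  shows "frob (P * C j k) (P * C j k) \<le> 2 * R * ((P *\<^sub>v u j) \<bullet> (P *\<^sub>v u j) + (P *\<^sub>v u k) \<bullet> (P *\<^sub>v u k))"
proof -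
  define v w where "v = P *\<^sub>v u j" and "w = P *\<^sub>v u k"
  have vw: "v \<in> carrier_vec D" "w \<in> carrier_vec D" unfolding v_def w_def using P j k u_carrier by auto
  have entry: "(P * C j k) $$ (a, b) = v $ a * u j $ b - w $ a * u k $ b" if "a < D" "b < D" for a b
  proof -
    have "(P * C j k) $$ (a, b) = (\<Sum>l<D. P $$ (a, l) * (u j $ l * u j $ b - u k $ l * u k $ b))"
      unfolding index_mult_mat_sum[OF P C_carrier that]
      using that j k by (intro sum.cong refl) (simp add: C_def wgram_def sum_unit_diff)
    also have "\<dots> = v $ a * u j $ b - w $ a * u k $ b"
      unfolding v_def w_def mult_mat_vec_sum[OF P u_carrier[OF j] that(1)] mult_mat_vec_sum[OF P u_carrier[OF k] that(1)]
        sum_distrib_right sum_subtractf[symmetric]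
      by (intro sum.cong refl) (simp add: algebra_simps)
    finally show ?thesis .
  qed
  have PC: "P * C j k \<in> carrier_mat D D" using P by simp
  have prod: "(\<Sum>a<D. \<Sum>b<D. (x $ a)\<^sup>2 * (y $ b)\<^sup>2) = (x \<bullet> x) * (y \<bullet> y)"
    if "x \<in> carrier_vec D" "y \<in> carrier_vec D" for x y :: "real vec"
    using that by (simp add: scalar_prod_sum[of _ D] sum_product power2_eq_square)
  have "frob (P * C j k) (P * C j k) = (\<Sum>a<D. \<Sum>b<D. (v $ a * u j $ b - w $ a * u k $ b)\<^sup>2)"
    unfolding frob_carrier[OF PC] by (intro sum.cong refl) (simp add: entry power2_eq_square del: index_mult_mat)
  also have "\<dots> \<le> (\<Sum>a<D. \<Sum>b<D. 2 * ((v $ a)\<^sup>2 * (u j $ b)\<^sup>2) + 2 * ((w $ a)\<^sup>2 * (u k $ b)\<^sup>2))"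
  proof (intro sum_mono)
    fix a b
    have "(x - y)\<^sup>2 \<le> 2 * x\<^sup>2 + 2 * y\<^sup>2" for x y :: real
      using sum_squares_bound[of x "-y"] by (simp add: power2_diff)
    from this[of "v $ a * u j $ b" "w $ a * u k $ b"]
    show "(v $ a * u j $ b - w $ a * u k $ b)\<^sup>2 \<le> 2 * ((v $ a)\<^sup>2 * (u j $ b)\<^sup>2) + 2 * ((w $ a)\<^sup>2 * (u k $ b)\<^sup>2)"
      by (simp add: power_mult_distrib)
  qed
  also have "\<dots> = 2 * ((v \<bullet> v) * (u j \<bullet> u j)) + 2 * ((w \<bullet> w) * (u k \<bullet> u k))"
    using vw u_carrier[OF j] u_carrier[OF k]
    by (simp only: sum.distrib sum_distrib_left[symmetric] prod[unfolded sum_distrib_left[symmetric]])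
  also have "\<dots> \<le> 2 * ((v \<bullet> v) * R) + 2 * ((w \<bullet> w) * R)"
    using u_le[OF j] u_le[OF k] vw
    by (intro add_mono mult_left_mono) (auto simp: scalar_prod_sum[of _ D] intro!: sum_nonneg)
  finally show ?thesis unfolding v_def w_def by (simp add: algebra_simps)
qed

lemma sqnorm_eq: "j < n \<Longrightarrow> sqnorm p h j = u j \<bullet> (X p ^\<^sub>m (2 * h) *\<^sub>v u j)"
  unfolding sqnorm_def using quadratic_form_even_power[OF X_sym u_carrier] by simp

lemma sum_chi_sqnorm:
  "(\<Sum>j<n. chi p j * sqnorm p h j) = frob (X p ^\<^sub>m h) (X p ^\<^sub>m Suc h)"
proof -
  have "(\<Sum>j<n. chi p j * sqnorm p h j) = frob (X p) (X p ^\<^sub>m (2 * h))"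
    by (simp add: frob_X sqnorm_eq)
  also have "\<dots> = frob (X p ^\<^sub>m 1) (X p ^\<^sub>m (2 * h))"
    by (simp add: left_mult_one_mat[of _ D D])
  also have "\<dots> = frob (X p ^\<^sub>m h) (X p ^\<^sub>m Suc h)"
    unfolding frob_pow[OF X_sym] by (simp add: mult_2)
  finally show ?thesis .
qed

text \<open>Exchanging the sums turns the left side into one frame sum for each row of the power, so
  no factor of the dimension arises.\<close>

lemma sum_sqnorm_le: "(\<Sum>j<n. sqnorm p h j) \<le> real n * frob (X p ^\<^sub>m h) (X p ^\<^sub>m h)"
proof -
  define P where "P = X p ^\<^sub>m h"
  have P: "P \<in> carrier_mat D D" unfolding P_def by simp
  have "(\<Sum>j<n. sqnorm p h j) = (\<Sum>j<n. \<Sum>a<D. (u j \<bullet> row P a)\<^sup>2)"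
  proof (intro sum.cong refl)
    fix j assume "j \<in> {..<n}"
    then have uj: "u j \<in> carrier_vec D" using u_carrier by simp
    then have "P *\<^sub>v u j \<in> carrier_vec D" using P by simp
    then show "sqnorm p h j = (\<Sum>a<D. (u j \<bullet> row P a)\<^sup>2)"
      unfolding sqnorm_def P_def[symmetric] scalar_prod_sum[of "P *\<^sub>v u j" D "P *\<^sub>v u j", OF \<open>P *\<^sub>v u j \<in> _\<close>]
      using P uj by (intro sum.cong refl) (auto simp: power2_eq_square comm_scalar_prod[of "row P _" D "u j"])
  qed
  also have "\<dots> = (\<Sum>a<D. \<Sum>j<n. (u j \<bullet> row P a)\<^sup>2)" by (rule sum.swap)
  also have "\<dots> \<le> (\<Sum>a<D. real n * (row P a \<bullet> row P a))"
    using P by (intro sum_mono frame) auto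
  also have "\<dots> = real n * frob P P"
    using P by (simp add: frob_carrier scalar_prod_sum[of _ D] sum_distrib_left)
  finally show ?thesis unfolding P_def .
qed

text \<open>Up to the factor \<open>card \<B>\<close>, the expectation of the trace of
  \<open>X p ^\<^sub>m (2 * h)\<close>.\<close>

definition T :: "nat \<Rightarrow> real" where "T h = (\<Sum>p\<in>\<B>. frob (X p ^\<^sub>m h) (X p ^\<^sub>m h))"

lemma T_nonneg: "0 \<le> T h"
  unfolding T_def by (intro sum_nonneg frob_self_nonneg)

text \<open>One factor \<open>X p\<close> is split off the trace of the power and expressed through
  exchanges, by \<open>sum_pairs_diff\<close> for the quadratic forms of the remaining odd
  power.\<close>

lemma T_Suc_eq:
  "real n * T (Suc h) = (\<Sum>p\<in>\<B>. \<Sum>j\<in>picked p. \<Sum>k\<in>unpicked p. frob (C j k) (X p ^\<^sub>m (2 * h + 1)))"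
proof -
  have "real n * frob (X p ^\<^sub>m Suc h) (X p ^\<^sub>m Suc h) =
     (\<Sum>j\<in>picked p. \<Sum>k\<in>unpicked p. frob (C j k) (X p ^\<^sub>m (2 * h + 1)))" if p: "p \<in> \<B>" for p
  proof -
    define f where "f j = u j \<bullet> (X p ^\<^sub>m (2 * h + 1) *\<^sub>v u j)" for j
    have "(\<Sum>j\<in>picked p. \<Sum>k\<in>unpicked p. frob (C j k) (X p ^\<^sub>m (2 * h + 1))) =
      (\<Sum>j\<in>picked p. \<Sum>k\<in>unpicked p. f j - f k)"
      by (intro sum.cong refl) (auto simp: frob_C f_def picked_def unpicked_def simp del: pow_mat.simps)
    also have "\<dots> = real n * frob (X p) (X p ^\<^sub>m (2 * h + 1))"
      unfolding sum_pairs_diff[OF p] f_def by (subst frob_X) simp_all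
    also have "frob (X p) (X p ^\<^sub>m (2 * h + 1)) = frob (X p ^\<^sub>m 1) (X p ^\<^sub>m (2 * h + 1))"
      by (simp add: left_mult_one_mat[of _ D D])
    also have "\<dots> = frob (X p ^\<^sub>m Suc h) (X p ^\<^sub>m Suc h)"
      unfolding frob_pow[OF X_sym] by (simp add: mult_2 del: pow_mat.simps)
    finally show ?thesis by simp
  qed
  then show ?thesis unfolding T_def sum_distrib_left by (intro sum.cong refl)
qed

lemma T_Suc_le:
  "real n * T (Suc h) \<le> real (2 * h + 1) * (2 * R) *
    ((real n - 2 * real s) * (\<Sum>p\<in>\<B>. frob (X p ^\<^sub>m h) (X p ^\<^sub>m Suc h))
     + 2 * real s * (real n - real s) / real n * (\<Sum>p\<in>\<B>. \<Sum>j<n. sqnorm p h j))"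
  (is "_ \<le> _ * ?Z")
proof -
  let ?S = "\<lambda>\<phi>. \<Sum>p\<in>\<B>. \<Sum>j\<in>picked p. \<Sum>k\<in>unpicked p. \<phi> p j k :: real"
  let ?t = "\<lambda>p j k. p \<circ> Transposition.transpose j k"
  \<comment> \<open>The exchange turns \<open>X p\<close> into its partner and \<open>C j k\<close>
    into \<open>C k j\<close>, its negative. Averaging both expressions for the moment produces a
    difference of odd powers.\<close>
  have "?S (\<lambda>p j k. frob (C j k) (X p ^\<^sub>m (2 * h + 1))) = ?S (\<lambda>p j k. - frob (C j k) (X (?t p j k) ^\<^sub>m (2 * h + 1)))"
    by (subst sum_swap, intro sum.cong refl) (auto simp: frob_C picked_def unpicked_def simp del: pow_mat.simps)
  then have "2 * (real n * T (Suc h))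
     = ?S (\<lambda>p j k. frob (C j k) (X p ^\<^sub>m (2 * h + 1))) + ?S (\<lambda>p j k. - frob (C j k) (X (?t p j k) ^\<^sub>m (2 * h + 1)))"
    unfolding T_Suc_eq by simp
  also have "\<dots> = ?S (\<lambda>p j k. frob (C j k) (X p ^\<^sub>m (2 * h + 1) - X (?t p j k) ^\<^sub>m (2 * h + 1)))"
    unfolding sum.distrib[symmetric]
    by (intro sum.cong refl, subst frob_diff_right[of _ D D]) (simp_all del: pow_mat.simps)
  also have "\<dots> \<le> ?S (\<lambda>p j k. real (2 * h + 1) * (2 * R) *
      ((sqnorm p h j + sqnorm p h k) + (sqnorm (?t p j k) h j + sqnorm (?t p j k) h k)))"
  proof (intro sum_mono)
    fix p j k assume "p \<in> \<B>" and jk: "j \<in> picked p" "k \<in> unpicked p"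
    then have jk': "j < n" "k < n" by (auto simp: picked_def unpicked_def)
    have "frob (C j k) (X p ^\<^sub>m (2 * h + 1) - X (?t p j k) ^\<^sub>m (2 * h + 1)) \<le>
       real (2 * h + 1) * (frob (X p ^\<^sub>m h * C j k) (X p ^\<^sub>m h * C j k) + frob (X (?t p j k) ^\<^sub>m h * C j k) (X (?t p j k) ^\<^sub>m h * C j k))"
      using frob_diff_pow_le[OF X_sym X_sym, of p "?t p j k" h] unfolding X_swap[OF jk] .
    also have "\<dots> \<le> real (2 * h + 1) * (2 * R * (sqnorm p h j + sqnorm p h k) + 2 * R * (sqnorm (?t p j k) h j + sqnorm (?t p j k) h k))"
      unfolding sqnorm_def using jk' by (intro mult_left_mono add_mono frob_mult_C_le) simp_all
    finally show "frob (C j k) (X p ^\<^sub>m (2 * h + 1) - X (?t p j k) ^\<^sub>m (2 * h + 1)) \<le> real (2 * h + 1) * (2 * R) *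
      ((sqnorm p h j + sqnorm p h k) + (sqnorm (?t p j k) h j + sqnorm (?t p j k) h k))"
      by (simp add: algebra_simps)
  qed
  also have "\<dots> = real (2 * h + 1) * (2 * R) * (?S (\<lambda>p j k. sqnorm p h j + sqnorm p h k)
      + ?S (\<lambda>p j k. sqnorm (?t p j k) h j + sqnorm (?t p j k) h k))"
    unfolding sum.distrib[symmetric] sum_distrib_left ..
  \<comment> \<open>By the same exchange, the contributions of the partner add up to those of
    \<open>X p\<close> itself.\<close>
  also have "?S (\<lambda>p j k. sqnorm (?t p j k) h j + sqnorm (?t p j k) h k) = ?S (\<lambda>p j k. sqnorm p h j + sqnorm p h k)"
    by (subst (2) sum_swap) (simp add: add.commute)
  also have "?S (\<lambda>p j k. sqnorm p h j + sqnorm p h k) =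
     (\<Sum>p\<in>\<B>. (real n - 2 * real s) * frob (X p ^\<^sub>m h) (X p ^\<^sub>m Suc h)
       + 2 * real s * (real n - real s) / real n * (\<Sum>j<n. sqnorm p h j))"
    by (intro sum.cong refl) (simp only: sum_pairs_add sum_chi_sqnorm)
  also have "\<dots> = (real n - 2 * real s) * (\<Sum>p\<in>\<B>. frob (X p ^\<^sub>m h) (X p ^\<^sub>m Suc h))
     + 2 * real s * (real n - real s) / real n * (\<Sum>p\<in>\<B>. \<Sum>j<n. sqnorm p h j)"
    by (simp only: sum.distrib sum_distrib_left)
  finally have *: "2 * (real n * T (Suc h)) \<le> real (2 * h + 1) * (2 * R) * (?Z + ?Z)" .
  have "2 * a \<le> K * (z + z) \<Longrightarrow> a \<le> K * z" for a K z :: real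
    unfolding distrib_left by linarith
  from this[OF *] show ?thesis .
qed

lemma e_nonneg: "0 \<le> e"
proof -
  have "0 \<le> real n * e"
    unfolding trace[symmetric] using u_carrier by (intro sum_nonneg) (simp add: scalar_prod_self_nonneg[of _ D])
  then show ?thesis using n_pos by (simp add: zero_le_mult_iff)
qed

text \<open>The first moment keeps the trace \<open>e\<close> instead of the dimension; later moments only multiply it.\<close>

lemma T_1_le: "T 1 \<le> 4 * R * real s * e * real (card \<B>)"
proof -
  let ?f = "\<lambda>j. u j \<bullet> u j"
  have e: "0 \<le> real n * e" using e_nonneg by simp
  have s0: "sqnorm p 0 j = ?f j" if "j < n" for p j
    using u_carrier[OF that] unfolding sqnorm_def by (simp add: carrier_matD[OF X_carrier])
  have "real n * (\<Sum>p\<in>\<B>. frob (X p ^\<^sub>m 0) (X p ^\<^sub>m Suc 0)) = (\<Sum>p\<in>\<B>. \<Sum>j\<in>picked p. \<Sum>k\<in>unpicked p. ?f j - ?f k)"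
    unfolding sum_distrib_left
  proof (rule sum.cong[OF refl])
    fix p assume p: "p \<in> \<B>"
    have "(\<Sum>j<n. chi p j * sqnorm p 0 j) = (\<Sum>j<n. chi p j * ?f j)" by (simp add: s0)
    then show "real n * frob (X p ^\<^sub>m 0) (X p ^\<^sub>m Suc 0) = (\<Sum>j\<in>picked p. \<Sum>k\<in>unpicked p. ?f j - ?f k)"
      unfolding sum_chi_sqnorm[symmetric] sum_pairs_diff[OF p] by simp
  qed
  \<comment> \<open>The summand does not involve \<open>p\<close> and changes sign when
    \<open>j\<close> and \<open>k\<close> trade places, so the exchange shows that its sum equals
    its own negative.\<close>
  also have "\<dots> = 0"
  proof -
    have "(\<Sum>p\<in>\<B>. \<Sum>j\<in>picked p. \<Sum>k\<in>unpicked p. ?f j - ?f k) = (\<Sum>p\<in>\<B>. \<Sum>j\<in>picked p. \<Sum>k\<in>unpicked p. - (?f j - ?f k))"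
      by (subst sum_swap) simp
    then show ?thesis by (simp only: sum_negf)
  qed
  finally have 0: "(\<Sum>p\<in>\<B>. frob (X p ^\<^sub>m 0) (X p ^\<^sub>m Suc 0)) = 0" using n_pos by simp
  have "(\<Sum>p\<in>\<B>. \<Sum>j<n. sqnorm p 0 j) = real (card \<B>) * (real n * e)"
    using s0 by (simp add: trace)
  then have "real n * T 1 \<le> 2 * R * (2 * real s * (real n - real s) / real n * (real (card \<B>) * (real n * e)))"
    using T_Suc_le[of 0] unfolding 0 by simp
  also have "\<dots> \<le> 2 * R * (2 * real s * 1 * (real (card \<B>) * (real n * e)))"
    unfolding times_divide_eq_right[symmetric] using R_nonneg e n_pos
    by (intro mult_left_mono mult_right_mono) (auto simp: divide_le_eq)
  also have "\<dots> = real n * (4 * R * real s * e * real (card \<B>))" by simp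
  finally show ?thesis using n_pos by simp
qed

text \<open>The bound in \<open>T_Suc_le\<close> contains a mixed term of the powers
  \<open>h\<close> and \<open>Suc h\<close>. Young's inequality splits it, and the half of
  \<open>T (Suc h)\<close> that this produces is absorbed on the left.\<close>

lemma T_Suc_le_T:
  fixes h defines "c \<equiv> real (2 * h + 1) * (2 * R)"
  shows "T (Suc h) \<le> (c\<^sup>2 + 4 * c * real s) * T h"
proof -
  have c: "0 \<le> c" unfolding c_def using R_nonneg by simp
  define x where "x = c * (real n - 2 * real s) / real n"
  have "\<bar>real n - 2 * real s\<bar> \<le> real n" using s_le_n by auto
  moreover have "\<bar>x\<bar> = c * \<bar>real n - 2 * real s\<bar> / real n" unfolding x_def using c by (simp add: abs_mult)
  ultimately have "\<bar>x\<bar> \<le> c * real n / real n" using c by (simp only:) (intro divide_right_mono mult_left_mono, auto)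
  then have "\<bar>x\<bar> \<le> \<bar>c\<bar>" using n_pos by simp
  then have x: "x\<^sup>2 \<le> c\<^sup>2" by (simp add: abs_le_square_iff)
  have "real n * T (Suc h) \<le> c * ((real n - 2 * real s) * (\<Sum>p\<in>\<B>. frob (X p ^\<^sub>m h) (X p ^\<^sub>m Suc h))
     + 2 * real s * (real n - real s) / real n * (\<Sum>p\<in>\<B>. \<Sum>j<n. sqnorm p h j))"
    unfolding c_def by (rule T_Suc_le)
  also have "\<dots> = real n * (x * (\<Sum>p\<in>\<B>. frob (X p ^\<^sub>m h) (X p ^\<^sub>m Suc h)))
     + c * (2 * real s * (real n - real s) / real n * (\<Sum>p\<in>\<B>. \<Sum>j<n. sqnorm p h j))"
  proof -
    have "real n * x = c * (real n - 2 * real s)" unfolding x_def using n_pos by simp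
    then show ?thesis unfolding mult.assoc[symmetric, of "real n" x] by (simp add: distrib_left mult.assoc)
  qed
  also have "x * (\<Sum>p\<in>\<B>. frob (X p ^\<^sub>m h) (X p ^\<^sub>m Suc h)) \<le> (\<Sum>p\<in>\<B>. (c\<^sup>2 * frob (X p ^\<^sub>m h) (X p ^\<^sub>m h) + frob (X p ^\<^sub>m Suc h) (X p ^\<^sub>m Suc h)) / 2)"
    unfolding sum_distrib_left
  proof (rule sum_mono)
    fix p
    have "x * frob (X p ^\<^sub>m h) (X p ^\<^sub>m Suc h) \<le> (x\<^sup>2 * frob (X p ^\<^sub>m h) (X p ^\<^sub>m h) + frob (X p ^\<^sub>m Suc h) (X p ^\<^sub>m Suc h)) / 2"
      by (intro frob_young[of _ D D]) (simp_all del: pow_mat.simps)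
    also have "\<dots> \<le> (c\<^sup>2 * frob (X p ^\<^sub>m h) (X p ^\<^sub>m h) + frob (X p ^\<^sub>m Suc h) (X p ^\<^sub>m Suc h)) / 2"
      using x by (simp add: mult_right_mono frob_self_nonneg del: pow_mat.simps)
    finally show "x * frob (X p ^\<^sub>m h) (X p ^\<^sub>m Suc h) \<le> \<dots>" .
  qed
  also have "(\<Sum>p\<in>\<B>. (c\<^sup>2 * frob (X p ^\<^sub>m h) (X p ^\<^sub>m h) + frob (X p ^\<^sub>m Suc h) (X p ^\<^sub>m Suc h)) / 2) = (c\<^sup>2 * T h + T (Suc h)) / 2"
    unfolding T_def by (simp only: sum_divide_distrib[symmetric] sum.distrib sum_distrib_left)
  also have "c * (2 * real s * (real n - real s) / real n * (\<Sum>p\<in>\<B>. \<Sum>j<n. sqnorm p h j)) \<le> c * (2 * real s * (real n - real s) / real n * (real n * T h))"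
    unfolding T_def sum_distrib_left[of "real n"] using s_le_n c
    by (intro mult_left_mono sum_mono sum_sqnorm_le) auto
  also have "\<dots> \<le> c * (2 * real s * real n * T h)"
    using n_pos c T_nonneg[of h] by (intro mult_left_mono) (auto intro!: mult_left_mono mult_right_mono)
  finally have "real n * T (Suc h) \<le> real n * ((c\<^sup>2 * T h + T (Suc h)) / 2 + 2 * c * real s * T h)"
    using n_pos by (simp add: algebra_simps)
  then have "T (Suc h) \<le> (c\<^sup>2 * T h + T (Suc h)) / 2 + 2 * c * real s * T h"
    using n_pos by simp
  then show ?thesis by (simp add: field_simps)
qed

text \<open>For \<open>h < Q\<close> the constant \<open>c\<close> of \<open>T_Suc_le_T\<close>
  satisfies \<open>c \<le> 4 * R * Q \<le> s\<close>. Hence \<open>c\<^sup>2\<close> is at most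
  \<open>c * s\<close>, and each step costs at most \<open>5 * (4 * R * Q) * s\<close>.\<close>

lemma T_le:
  assumes Q: "4 * R * real Q \<le> real s" and h: "1 \<le> h" "h \<le> Q"
  shows "T h \<le> (20 * R * real Q * real s) ^ h * (e * real (card \<B>))"
  using h
proof (induction h rule: dec_induct)
  case base
  have "4 * R * real s * e * real (card \<B>) \<le> 20 * R * real Q * real s * (e * real (card \<B>))"
    using mult_right_mono[of 4 "20 * real Q" "R * real s * (e * real (card \<B>))"] h R_nonneg e_nonneg
    by (simp add: mult_ac)
  from order_trans[OF T_1_le this] show ?case by simp
next
  case (step h)
  define c where "c = real (2 * h + 1) * (2 * R)"
  have c0: "0 \<le> c" unfolding c_def using R_nonneg by simp
  have "c \<le> 4 * R * real Q"
  proof -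
    have "real (2 * h + 1) \<le> 2 * real Q" using step by linarith
    then have "c \<le> 2 * real Q * (2 * R)" unfolding c_def using R_nonneg by (intro mult_right_mono) auto
    then show ?thesis by (simp add: mult_ac)
  qed
  moreover from this have "c \<le> real s" using Q by simp
  ultimately have "c\<^sup>2 + 4 * c * real s \<le> 5 * (4 * R * real Q) * real s"
    using c0 mult_left_mono[of c "real s" c] mult_right_mono[of c "4 * R * real Q" "real s"]
    by (simp add: power2_eq_square)
  then have "(c\<^sup>2 + 4 * c * real s) * T h \<le> 5 * (4 * R * real Q) * real s * T h"
    by (rule mult_right_mono[OF _ T_nonneg])
  with T_Suc_le_T[of h] have "T (Suc h) \<le> 5 * (4 * R * real Q) * real s * T h"
    unfolding c_def[symmetric] by (rule order_trans)
  then have "T (Suc h) \<le> (20 * R * real Q * real s) * T h" by (simp add: mult.assoc)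
  also have "\<dots> \<le> (20 * R * real Q * real s) * ((20 * R * real Q * real s) ^ h * (e * real (card \<B>)))"
    using step R_nonneg by (intro mult_left_mono) auto
  finally show ?case by simp
qed

text \<open>By Cauchy-Schwarz the squared norms \<open>a k\<close> of the iterates of
  \<open>y\<close> are log-convex, so the ratio of consecutive terms, above
  \<open>\<rho>\<^sup>2\<close> at the start, never falls below it. The Frobenius norm of the power
  dominates the growth of this one vector.\<close>

lemma deviation_le_frob:
  assumes "0 < \<rho>" "y \<in> carrier_vec D" and dev: "\<rho>\<^sup>2 * (y \<bullet> y) < (X p *\<^sub>v y) \<bullet> (X p *\<^sub>v y)"
  shows "\<rho> ^ (2 * Q) \<le> frob (X p ^\<^sub>m Q) (X p ^\<^sub>m Q)"
proof -
  define a where "a k = (X p ^\<^sub>m k *\<^sub>v y) \<bullet> (X p ^\<^sub>m k *\<^sub>v y)" for k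
  have c: "X p ^\<^sub>m k *\<^sub>v y \<in> carrier_vec D" for k using assms(2) by (intro mult_mat_vec_carrier) auto
  have a0: "a 0 = y \<bullet> y" and a1: "a 1 = (X p *\<^sub>v y) \<bullet> (X p *\<^sub>v y)"
    using assms(2) carrier_matD[OF X_carrier] unfolding a_def by (simp_all add: left_mult_one_mat[of _ D D])
  have a_ge: "0 \<le> a k" for k using scalar_prod_self_nonneg[OF c] unfolding a_def .
  have "y \<bullet> y \<noteq> 0"
  proof
    assume y0: "y \<bullet> y = 0"
    have "(X p *\<^sub>v y) \<bullet> (X p *\<^sub>v y) \<le> frob (X p) (X p) * (y \<bullet> y)"
      by (rule norm_mult_mat_vec_le[of _ D D]) (use assms in auto)
    then show False using dev y0 by simp
  qed
  then have a0_pos: "0 < a 0" using a0 a_ge[of 0] by simp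
  have "0 < a k \<and> \<rho>\<^sup>2 * a k \<le> a (Suc k)" for k
  proof (induction k)
    case 0
    then show ?case using a0 a1 dev a0_pos by simp
  next
    case (Suc k)
    have X: "X p ^\<^sub>m Suc j *\<^sub>v y = X p *\<^sub>v (X p ^\<^sub>m j *\<^sub>v y)" for j
      using pow_mat_add[OF X_carrier, of p 1 j] assms(2) by (simp add: left_mult_one_mat[of _ D D] assoc_mult_mat_vec[of _ D D _ D])
    have "a (Suc k) = (X p ^\<^sub>m k *\<^sub>v y) \<bullet> (X p ^\<^sub>m Suc (Suc k) *\<^sub>v y)"
      using symmetric_scalar_prod[OF X_sym[of p] c[of k] c[of "Suc k"]] by (simp only: a_def X)
    then have cs: "(a (Suc k))\<^sup>2 \<le> a k * a (Suc (Suc k))"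
      using scalar_prod_Cauchy_Schwarz[OF c c] unfolding a_def by metis
    have pos: "0 < a (Suc k)" using Suc \<open>0 < \<rho>\<close> by (smt (verit) mult_pos_pos zero_less_power)
    have "a k * (\<rho>\<^sup>2 * a (Suc k)) \<le> a (Suc k) * a (Suc k)"
      using Suc pos mult_right_mono[of "\<rho>\<^sup>2 * a k" "a (Suc k)" "a (Suc k)"] by (simp add: mult_ac)
    then have "a k * (\<rho>\<^sup>2 * a (Suc k)) \<le> a k * a (Suc (Suc k))" using cs by (simp add: power2_eq_square)
    then show ?case using Suc pos by simp
  qed
  then have "(\<rho>\<^sup>2) ^ k * a 0 \<le> a k" for k
  proof (induction k)
    case (Suc k)
    have "(\<rho>\<^sup>2) ^ Suc k * a 0 \<le> \<rho>\<^sup>2 * a k" using Suc by (simp add: mult_left_mono mult.assoc)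
    then show ?case using Suc.prems[of k] by simp
  qed simp
  then have "\<rho> ^ (2 * Q) * a 0 \<le> a Q" by (simp add: power_mult)
  also have "\<dots> \<le> frob (X p ^\<^sub>m Q) (X p ^\<^sub>m Q) * a 0"
    unfolding a0 unfolding a_def by (rule norm_mult_mat_vec_le[of _ D D]) (use assms in auto)
  finally show ?thesis using a0_pos by simp
qed

text \<open>Markov's inequality for the moment of order \<open>2 * Q\<close>, in counting
  form.\<close>

lemma card_deviation_le:
  assumes "0 < \<rho>" and Q: "4 * R * real Q \<le> real s" "1 \<le> Q"
  shows "real (card {p \<in> \<B>. \<exists>y\<in>carrier_vec D. \<rho>\<^sup>2 * (y \<bullet> y) < (X p *\<^sub>v y) \<bullet> (X p *\<^sub>v y)})
    \<le> (20 * R * real Q * real s / \<rho>\<^sup>2) ^ Q * e * real (card \<B>)"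
    (is "real (card ?bad) \<le> _")
proof -
  have "real (card ?bad) * \<rho> ^ (2 * Q) = (\<Sum>p\<in>?bad. \<rho> ^ (2 * Q))" by simp
  also have "\<dots> \<le> (\<Sum>p\<in>?bad. frob (X p ^\<^sub>m Q) (X p ^\<^sub>m Q))"
    by (intro sum_mono) (use deviation_le_frob[OF assms(1)] in blast)
  also have "\<dots> \<le> T Q" unfolding T_def
    by (intro sum_mono2 finite_B) (auto intro: frob_self_nonneg)
  also have "\<dots> \<le> (20 * R * real Q * real s) ^ Q * (e * real (card \<B>))"
    by (rule T_le[OF Q(1)]) (use Q in auto)
  finally have "real (card ?bad) \<le> (20 * R * real Q * real s) ^ Q * (e * real (card \<B>)) / \<rho> ^ (2 * Q)"
    using assms(1) by (simp add: pos_le_divide_eq)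
  then show ?thesis by (simp add: power_divide power_mult)
qed

end

subsection \<open>Definite matrices and extremal eigenvalues\<close>

lemma left_inverse_norm:
  assumes "B \<in> carrier_mat d d" "P \<in> carrier_mat d d" "B * P = 1\<^sub>m d" "v \<in> carrier_vec d"
  shows "v \<bullet> v \<le> frob B B * ((P *\<^sub>v v) \<bullet> (P *\<^sub>v v))"
proof -
  have "B *\<^sub>v (P *\<^sub>v v) = v" using assms by (simp flip: assoc_mult_mat_vec)
  then show ?thesis using norm_mult_mat_vec_le[of B d d "P *\<^sub>v v"] assms by simp
qed

lemma mat_inverse_if_inj:
  fixes P :: "real mat"
  assumes P: "P \<in> carrier_mat d d" and inj: "\<And>v. v \<in> carrier_vec d \<Longrightarrow> v \<noteq> 0\<^sub>v d \<Longrightarrow> P *\<^sub>v v \<noteq> 0\<^sub>v d"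
  obtains B where "mat_inverse P = Some B" "B \<in> carrier_mat d d" "P * B = 1\<^sub>m d" "B * P = 1\<^sub>m d"
proof -
  have "det P \<noteq> 0" using det_0_iff_vec_prod_zero[OF P] inj by blast
  then have "P \<in> Units (ring_mat TYPE(real) d ())" by (rule det_non_zero_imp_unit[OF P])
  then have "mat_inverse P \<noteq> None" using mat_inverse(1)[OF P, of "()"] by blast
  then obtain B where "mat_inverse P = Some B" by blast
  then show ?thesis using that mat_inverse(2)[OF P] by blast
qed

lemma quadratic_form_le:
  assumes P: "P \<in> carrier_mat d d" and x: "x \<in> carrier_vec d"
  shows "x \<bullet> (P *\<^sub>v x) \<le> (1 + frob P P) / 2 * (x \<bullet> x)"
  using scalar_prod_le_squares[of x d "P *\<^sub>v x"] norm_mult_mat_vec_le[OF P x] x P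
  by (simp add: field_simps)

text \<open>Nonnegativity of the form at \<open>v - (1 / \<kappa>) P v\<close> bounds the squared
  norm of \<open>P v\<close> by \<open>\<kappa>\<close> times the form at \<open>v\<close>, and
  invertibility bounds \<open>v\<close> by \<open>P v\<close>. The argument avoids eigenvectors,
  since it serves to construct one.\<close>

lemma psd_gap:
  assumes P: "symmetric_mat d P" and psd: "\<And>v. v \<in> carrier_vec d \<Longrightarrow> 0 \<le> v \<bullet> (P *\<^sub>v v)"
    and inj: "\<And>v. v \<in> carrier_vec d \<Longrightarrow> v \<noteq> 0\<^sub>v d \<Longrightarrow> P *\<^sub>v v \<noteq> 0\<^sub>v d"
  obtains c where "0 < c" "\<And>v. v \<in> carrier_vec d \<Longrightarrow> c * (v \<bullet> v) \<le> v \<bullet> (P *\<^sub>v v)"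
proof -
  have Pc: "P \<in> carrier_mat d d" using P by (rule symmetric_matD)
  obtain B where B: "B \<in> carrier_mat d d" "B * P = 1\<^sub>m d" using mat_inverse_if_inj[OF Pc inj] by metis
  define \<kappa> where "\<kappa> = (1 + frob P P) / 2"
  \<comment> \<open>The added \<open>1\<close> keeps \<open>K\<close> positive in dimension
    \<open>0\<close>, where \<open>frob B B\<close> vanishes.\<close>
  define K where "K = frob B B + 1"
  have pos: "0 < \<kappa>" "0 < K" using frob_self_nonneg[of P] frob_self_nonneg[of B] unfolding \<kappa>_def K_def by auto
  have up: "x \<bullet> (P *\<^sub>v x) \<le> \<kappa> * (x \<bullet> x)" if x: "x \<in> carrier_vec d" for x
    unfolding \<kappa>_def using quadratic_form_le[OF Pc x] .
  show ?thesis
  proof (rule that[of "1 / (\<kappa> * K)"])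
    show "0 < 1 / (\<kappa> * K)" using pos by simp
    fix v :: "real vec" assume v: "v \<in> carrier_vec d"
    define w where "w = P *\<^sub>v v"
    have w: "w \<in> carrier_vec d" unfolding w_def using Pc v by simp
    define x where "x = v - (1 / \<kappa>) \<cdot>\<^sub>v w"
    have x: "x \<in> carrier_vec d" unfolding x_def using v w by simp
    have Pw: "P *\<^sub>v w \<in> carrier_vec d" using Pc w by simp
    have Px: "P *\<^sub>v x = w - (1 / \<kappa>) \<cdot>\<^sub>v (P *\<^sub>v w)"
      unfolding x_def using Pc v w by (simp add: mult_minus_distrib_mat_vec[of _ d d] mult_mat_vec[of _ d d] w_def)
    have vPw: "v \<bullet> (P *\<^sub>v w) = w \<bullet> w"
      using symmetric_scalar_prod[OF P v w] unfolding w_def .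
    have "0 \<le> x \<bullet> (P *\<^sub>v x)" using psd[OF x] .
    also have "x \<bullet> (P *\<^sub>v x) = v \<bullet> w - 2 / \<kappa> * (w \<bullet> w) + (1 / \<kappa>)\<^sup>2 * (w \<bullet> (P *\<^sub>v w))"
      unfolding Px unfolding x_def using v w Pw vPw
      by (simp add: minus_scalar_prod_distrib[of _ d] scalar_prod_minus_distrib[of _ d] power2_eq_square field_simps)
    also have "\<dots> \<le> v \<bullet> w - 2 / \<kappa> * (w \<bullet> w) + (1 / \<kappa>)\<^sup>2 * (\<kappa> * (w \<bullet> w))"
      using up[OF w] by (intro add_left_mono mult_left_mono) auto
    also have "\<dots> = v \<bullet> w - (w \<bullet> w) / \<kappa>" using pos by (simp add: power2_eq_square field_simps)
    finally have 1: "(w \<bullet> w) / \<kappa> \<le> v \<bullet> w" by simp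
    have "v \<bullet> v \<le> frob B B * (w \<bullet> w)" unfolding w_def by (rule left_inverse_norm[OF B(1) Pc B(2) v])
    also have "\<dots> \<le> K * (w \<bullet> w)" unfolding K_def using scalar_prod_self_nonneg[OF w] by (intro mult_right_mono) auto
    finally have "1 / (\<kappa> * K) * (v \<bullet> v) \<le> 1 / (\<kappa> * K) * (K * (w \<bullet> w))"
      using pos by (intro mult_left_mono) auto
    also have "\<dots> = (w \<bullet> w) / \<kappa>" using pos by simp
    finally show "1 / (\<kappa> * K) * (v \<bullet> v) \<le> v \<bullet> (P *\<^sub>v v)" using 1 unfolding w_def by linarith
  qed
qed

section \<open>Extremal Rayleigh quotients and singular values\<close>

lemma smult_mat_mult_vec:
  fixes M :: "real mat"
  assumes "M \<in> carrier_mat r c" "v \<in> carrier_vec c"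
  shows "(k \<cdot>\<^sub>m M) *\<^sub>v v = k \<cdot>\<^sub>v (M *\<^sub>v v)"
  using assms by (intro eq_vecI) (auto simp: mult_mat_vec_sum[of _ r c] sum_distrib_left mult.assoc simp del: index_mult_mat_vec)

text \<open>\<open>k\<close> is the least constant bounding the form. If \<open>k I - H\<close> were
  injective, \<open>psd_gap\<close> would leave room to lower \<open>k\<close>; so it has a kernel
  vector, which is an eigenvector of \<open>H\<close>. This stands in for compactness of the
  sphere.\<close>

lemma rayleigh_max:
  assumes H: "symmetric_mat d H" and "0 < d"
  obtains k v where "v \<in> carrier_vec d" "v \<noteq> 0\<^sub>v d" "H *\<^sub>v v = k \<cdot>\<^sub>v v"
    "\<And>v. v \<in> carrier_vec d \<Longrightarrow> v \<bullet> (H *\<^sub>v v) \<le> k * (v \<bullet> v)"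
proof -
  have Hc: "H \<in> carrier_mat d d" using H by (rule symmetric_matD)
  define S where "S = {k. \<forall>v\<in>carrier_vec d. v \<bullet> (H *\<^sub>v v) \<le> k * (v \<bullet> v)}"
  have "(1 + frob H H) / 2 \<in> S"
    unfolding S_def using quadratic_form_le[OF Hc] by blast
  then have ne: "S \<noteq> {}" by auto
  \<comment> \<open>The first unit vector, available since \<open>0 < d\<close>, bounds
    \<open>S\<close> from below.\<close>
  define e where "e = unit_vec d 0 \<bullet> (H *\<^sub>v unit_vec d 0)"
  have ee: "unit_vec d 0 \<bullet> (unit_vec d 0 :: real vec) = 1" using \<open>0 < d\<close> by simp
  have bdd: "bdd_below S"
  proof (rule bdd_belowI[of _ e])
    fix x assume "x \<in> S"
    then have "e \<le> x * (unit_vec d 0 \<bullet> unit_vec d 0)"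
      unfolding S_def e_def using unit_vec_carrier by blast
    then show "e \<le> x" unfolding ee by simp
  qed
  define k where "k = Inf S"
  have kS: "v \<bullet> (H *\<^sub>v v) \<le> k * (v \<bullet> v)" if v: "v \<in> carrier_vec d" for v
  proof (cases "v \<bullet> v = 0")
    case True
    then have "v = 0\<^sub>v d" using scalar_prod_self_eq_0[OF v] by simp
    then show ?thesis using Hc by simp
  next
    case False
    then have pos: "0 < v \<bullet> v" using scalar_prod_self_nonneg[OF v] by simp
    have "v \<bullet> (H *\<^sub>v v) / (v \<bullet> v) \<le> Inf S"
      using v pos by (intro cInf_greatest ne) (simp add: S_def divide_le_eq)
    then show ?thesis using pos unfolding k_def by (simp add: divide_le_eq)
  qed
  define P where "P = k \<cdot>\<^sub>m 1\<^sub>m d - H"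
  have P: "symmetric_mat d P" using H unfolding P_def symmetric_mat_def
    by (auto simp: transpose_minus[of _ d d] intro!: eq_matI)
  have Pv: "P *\<^sub>v v = k \<cdot>\<^sub>v v - H *\<^sub>v v" if "v \<in> carrier_vec d" for v
  proof -
    have "(k \<cdot>\<^sub>m 1\<^sub>m d) *\<^sub>v v = k \<cdot>\<^sub>v v" using that by (simp add: smult_mat_mult_vec[of _ d d])
    then show ?thesis unfolding P_def using Hc that by (simp add: minus_mult_distrib_mat_vec[of _ d d])
  qed
  have vPv: "v \<bullet> (P *\<^sub>v v) = k * (v \<bullet> v) - v \<bullet> (H *\<^sub>v v)" if "v \<in> carrier_vec d" for v
    unfolding Pv[OF that] using that Hc by (simp add: scalar_prod_minus_distrib[of _ d])
  have "\<exists>v. v \<in> carrier_vec d \<and> v \<noteq> 0\<^sub>v d \<and> P *\<^sub>v v = 0\<^sub>v d"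
  proof (rule ccontr)
    assume inj: "\<not> ?thesis"
    obtain c where c: "0 < c" "\<And>v. v \<in> carrier_vec d \<Longrightarrow> c * (v \<bullet> v) \<le> v \<bullet> (P *\<^sub>v v)"
      by (rule psd_gap[OF P]) (use kS vPv inj in auto)
    have "k - c \<in> S" unfolding S_def using c(2) vPv by (auto simp: left_diff_distrib) (smt (verit))
    then have "k \<le> k - c" unfolding k_def by (rule cInf_lower[OF _ bdd])
    then show False using c(1) by simp
  qed
  then obtain v where v: "v \<in> carrier_vec d" "v \<noteq> 0\<^sub>v d" and 0: "P *\<^sub>v v = 0\<^sub>v d" by blast
  have "H *\<^sub>v v = k \<cdot>\<^sub>v v"
  proof (rule eq_vecI)
    fix a assume "a < dim_vec (k \<cdot>\<^sub>v v)"
    then have a: "a < d" using v by simp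
    then have "(k \<cdot>\<^sub>v v - H *\<^sub>v v) $ a = 0" using 0 Pv[OF v(1)] by simp
    then show "(H *\<^sub>v v) $ a = (k \<cdot>\<^sub>v v) $ a" using a v Hc by simp
  qed (use v Hc in auto)
  then show ?thesis using that v kS by blast
qed

lemma rayleigh_min:
  assumes H: "symmetric_mat d H" and "0 < d"
  obtains k v where "v \<in> carrier_vec d" "v \<noteq> 0\<^sub>v d" "H *\<^sub>v v = k \<cdot>\<^sub>v v"
    "\<And>v. v \<in> carrier_vec d \<Longrightarrow> k * (v \<bullet> v) \<le> v \<bullet> (H *\<^sub>v v)"
proof -
  have Hc: "H \<in> carrier_mat d d" using H by (rule symmetric_matD)
  have "symmetric_mat d (- H)" using H unfolding symmetric_mat_def by (simp add: transpose_uminus)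
  then obtain k v where v: "v \<in> carrier_vec d" "v \<noteq> 0\<^sub>v d" and ev: "(- H) *\<^sub>v v = k \<cdot>\<^sub>v v"
    and le: "\<And>v. v \<in> carrier_vec d \<Longrightarrow> v \<bullet> (- H *\<^sub>v v) \<le> k * (v \<bullet> v)"
    using rayleigh_max[OF _ \<open>0 < d\<close>] by metis
  have "H *\<^sub>v v = (- k) \<cdot>\<^sub>v v"
  proof (rule eq_vecI)
    fix a assume "a < dim_vec (- k \<cdot>\<^sub>v v)"
    then have a: "a < d" using v by simp
    have "(- (H *\<^sub>v v)) $ a = (k \<cdot>\<^sub>v v) $ a" using ev v Hc by simp
    then show "(H *\<^sub>v v) $ a = (- k \<cdot>\<^sub>v v) $ a" using a v Hc by (simp del: index_mult_mat_vec)
  qed (use v Hc in auto)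
  moreover have "- k * (v \<bullet> v) \<le> v \<bullet> (H *\<^sub>v v)" if "v \<in> carrier_vec d" for v
    using le[OF that] that Hc by simp
  ultimately show ?thesis using that v by blast
qed

lemma singular_value_if_eigenvector:
  assumes H: "symmetric_mat d H" and v: "v \<in> carrier_vec d" "v \<noteq> 0\<^sub>v d" "H *\<^sub>v v = k \<cdot>\<^sub>v v" and "0 \<le> k"
  shows "k \<in> singular_values H"
proof -
  have Hc: "H \<in> carrier_mat d d" "transpose_mat H = H" using H by (auto dest: symmetric_matD)
  have "(H * H) *\<^sub>v v = k\<^sup>2 \<cdot>\<^sub>v v"
    using Hc v by (simp add: mult_mat_vec[of _ d d] smult_smult_assoc power2_eq_square)
  then have "eigenvalue (transpose_mat H * H) (k\<^sup>2)"
    unfolding eigenvalue_def eigenvector_def using Hc v by auto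
  then show ?thesis unfolding singular_values_def using \<open>0 \<le> k\<close> by force
qed

text \<open>Eigenvalues are roots of the characteristic polynomial. Finiteness is what gives
  \<open>Max\<close> and \<open>Min\<close> their meaning in \<open>sigma_max\<close> and
  \<open>sigma_min\<close>.\<close>

lemma finite_singular_values:
  assumes "M \<in> carrier_mat r d"
  shows "finite (singular_values M)"
proof -
  have MM: "transpose_mat M * M \<in> carrier_mat d d" using assms by simp
  have "char_poly (transpose_mat M * M) \<noteq> 0" using degree_monic_char_poly[OF MM] by auto
  then have "finite {k. eigenvalue (transpose_mat M * M) k}"
    unfolding eigenvalue_root_char_poly[OF MM] by (rule poly_roots_finite)
  then show ?thesis unfolding singular_values_def by simp
qed

lemma singular_values_pos:
  assumes H: "symmetric_mat d H" and pd: "\<And>v. v \<in> carrier_vec d \<Longrightarrow> v \<noteq> 0\<^sub>v d \<Longrightarrow> 0 < v \<bullet> (H *\<^sub>v v)"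
    and x: "x \<in> singular_values H"
  shows "0 < x"
proof -
  have Hc: "H \<in> carrier_mat d d" "transpose_mat H = H" using H by (auto dest: symmetric_matD)
  obtain k v where k: "x = sqrt k" and v: "v \<in> carrier_vec d" "v \<noteq> 0\<^sub>v d" "(H * H) *\<^sub>v v = k \<cdot>\<^sub>v v"
    using x Hc unfolding singular_values_def eigenvalue_def eigenvector_def by auto
  have Hv: "H *\<^sub>v v \<in> carrier_vec d" using Hc v by simp
  have "k * (v \<bullet> v) = v \<bullet> (H *\<^sub>v (H *\<^sub>v v))" using v Hc by simp
  also have "\<dots> = (H *\<^sub>v v) \<bullet> (H *\<^sub>v v)" using symmetric_scalar_prod[OF H v(1) Hv] .
  finally have eq: "k * (v \<bullet> v) = (H *\<^sub>v v) \<bullet> (H *\<^sub>v v)" .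
  have "H *\<^sub>v v \<noteq> 0\<^sub>v d" using pd[OF v(1,2)] v by auto
  then have "0 < (H *\<^sub>v v) \<bullet> (H *\<^sub>v v)" using scalar_prod_self_nonneg[OF Hv] scalar_prod_self_eq_0[OF Hv] by linarith
  then have "0 < k * (v \<bullet> v)" unfolding eq .
  then have "0 < k" using scalar_prod_self_nonneg[OF v(1)] by (simp add: zero_less_mult_iff)
  then show ?thesis unfolding k by simp
qed

text \<open>The extremal Rayleigh quotients are eigenvalues, positive by definiteness, hence
  singular values; so they lie between the minimum and the maximum of that set.\<close>

lemma sigma_bounds:
  assumes H: "symmetric_mat d H" and "0 < d"
    and pd: "\<And>v. v \<in> carrier_vec d \<Longrightarrow> v \<noteq> 0\<^sub>v d \<Longrightarrow> 0 < v \<bullet> (H *\<^sub>v v)"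
  shows "0 < sigma_min H"
    and "\<And>v. v \<in> carrier_vec d \<Longrightarrow> sigma_min H * (v \<bullet> v) \<le> v \<bullet> (H *\<^sub>v v)"
    and "\<And>v. v \<in> carrier_vec d \<Longrightarrow> v \<bullet> (H *\<^sub>v v) \<le> sigma_max H * (v \<bullet> v)"
proof -
  have fin: "finite (singular_values H)" by (rule finite_singular_values[OF symmetric_matD(1)[OF H]])
  have ev: "k \<in> singular_values H" if v: "v \<in> carrier_vec d" "v \<noteq> 0\<^sub>v d" "H *\<^sub>v v = k \<cdot>\<^sub>v v" for k v
  proof (rule singular_value_if_eigenvector[OF H v])
    have "0 < k * (v \<bullet> v)" using pd[OF v(1,2)] v by simp
    then show "0 \<le> k" using scalar_prod_self_nonneg[OF v(1)] by (simp add: zero_less_mult_iff)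
  qed
  obtain k where k: "k \<in> singular_values H" and k_le: "\<And>v. v \<in> carrier_vec d \<Longrightarrow> k * (v \<bullet> v) \<le> v \<bullet> (H *\<^sub>v v)"
    using rayleigh_min[OF H \<open>0 < d\<close>] ev by metis
  obtain l where l: "l \<in> singular_values H" and l_ge: "\<And>v. v \<in> carrier_vec d \<Longrightarrow> v \<bullet> (H *\<^sub>v v) \<le> l * (v \<bullet> v)"
    using rayleigh_max[OF H \<open>0 < d\<close>] ev by metis
  show "0 < sigma_min H" unfolding sigma_min_def using singular_values_pos[OF H pd] fin k
    by (subst Min_gr_iff) auto
  have "sigma_min H \<le> k" "l \<le> sigma_max H" unfolding sigma_min_def sigma_max_def using fin k l by auto
  then show "\<And>v. v \<in> carrier_vec d \<Longrightarrow> sigma_min H * (v \<bullet> v) \<le> v \<bullet> (H *\<^sub>v v)"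
    "\<And>v. v \<in> carrier_vec d \<Longrightarrow> v \<bullet> (H *\<^sub>v v) \<le> sigma_max H * (v \<bullet> v)"
    using k_le l_ge scalar_prod_self_nonneg by (meson mult_right_mono order_trans)+
qed

text \<open>An inverse satisfies all Penrose equations, and \<open>M * X * M = M\<close> forces any
  solution to be \<open>B\<close>, by multiplying with \<open>B\<close> on both sides.\<close>

lemma pseudoinverse_eq:
  assumes M: "M \<in> carrier_mat d d" and B: "B \<in> carrier_mat d d" "M * B = 1\<^sub>m d" "B * M = 1\<^sub>m d"
  shows "pseudoinverse M = B"
  unfolding pseudoinverse_def
proof (rule the_equality)
  show "B \<in> carrier_mat (dim_col M) (dim_row M) \<and> M * B * M = M \<and> B * M * B = B
    \<and> transpose_mat (M * B) = M * B \<and> transpose_mat (B * M) = B * M"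
    using assms by simp
next
  fix X assume X: "X \<in> carrier_mat (dim_col M) (dim_row M) \<and> M * X * M = M \<and> X * M * X = X
    \<and> transpose_mat (M * X) = M * X \<and> transpose_mat (X * M) = X * M"
  then have Xc: "X \<in> carrier_mat d d" and MXM: "M * X * M = M" using M by auto
  have "X = (B * M) * X * (M * B)" using Xc B by simp
  also have "\<dots> = B * (M * X * M) * B" using M Xc B(1) by (simp add: assoc_mult_mat[of _ d d _ d _ d])
  also have "\<dots> = B" unfolding MXM using assms by simp
  finally show "X = B" .
qed

subsection \<open>Regularised Gram matrices\<close>

lemma regularized_gram_carrier [simp]: "A \<in> carrier_mat r d \<Longrightarrow> regularized_gram A \<gamma> \<in> carrier_mat d d"
  unfolding regularized_gram_def by auto

lemma regularized_gram_form:
  assumes A: "A \<in> carrier_mat r d" and v: "v \<in> carrier_vec d" and w: "w \<in> carrier_vec d"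
  shows "v \<bullet> (regularized_gram A \<gamma> *\<^sub>v w) =
    1 / real r * (\<Sum>j<r. (row A j \<bullet> v) * (row A j \<bullet> w)) + \<gamma> * (v \<bullet> w)"
proof -
  have Av: "A *\<^sub>v v \<in> carrier_vec r" "A *\<^sub>v w \<in> carrier_vec r" using A v w by auto
  have AAw: "transpose_mat A *\<^sub>v (A *\<^sub>v w) \<in> carrier_vec d" using A Av by auto
  have "v \<bullet> (transpose_mat A *\<^sub>v (A *\<^sub>v w)) = (transpose_mat A *\<^sub>v (A *\<^sub>v w)) \<bullet> v"
    using v AAw by (rule comm_scalar_prod)
  also have "\<dots> = (A *\<^sub>v w) \<bullet> (A *\<^sub>v v)" by (rule transpose_vec_mult_scalar[OF A v Av(2)])
  also have "\<dots> = (\<Sum>j<r. (row A j \<bullet> v) * (row A j \<bullet> w))"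
    unfolding scalar_prod_sum[OF Av(1)] using A by (intro sum.cong) auto
  finally have *: "v \<bullet> (transpose_mat A *\<^sub>v (A *\<^sub>v w)) = (\<Sum>j<r. (row A j \<bullet> v) * (row A j \<bullet> w))" .
  have TA: "transpose_mat A * A \<in> carrier_mat d d" using A by simp
  have "regularized_gram A \<gamma> *\<^sub>v w = (1 / real r) \<cdot>\<^sub>v (transpose_mat A *\<^sub>v (A *\<^sub>v w)) + \<gamma> \<cdot>\<^sub>v w"
    unfolding regularized_gram_def using A w TA
    by (simp add: add_mult_distrib_mat_vec[of _ d d] smult_mat_mult_vec[of _ d d])
  then show ?thesis using v w AAw * by (simp add: scalar_prod_add_distrib[of _ d])
qed

lemma symmetric_regularized_gram:
  assumes A: "A \<in> carrier_mat r d"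
  shows "symmetric_mat d (regularized_gram A \<gamma>)"
proof -
  have "transpose_mat (transpose_mat A * A) = transpose_mat A * A"
    using A by (simp add: transpose_mult[of _ d r _ d])
  then have "(transpose_mat A * A) $$ (j, i) = (transpose_mat A * A) $$ (i, j)" if "i < d" "j < d" for i j
    using A that by (metis index_transpose_mat(1) index_mult_mat(2,3) carrier_matD(2) index_transpose_mat(2))
  then show ?thesis unfolding symmetric_mat_def regularized_gram_def
    using A by (intro conjI eq_matI) (auto simp del: index_mult_mat(1))
qed

lemma regularized_gram_pos:
  assumes A: "A \<in> carrier_mat r d" and "0 < \<gamma>" and v: "v \<in> carrier_vec d" "v \<noteq> 0\<^sub>v d"
  shows "0 < v \<bullet> (regularized_gram A \<gamma> *\<^sub>v v)"
proof -
  have "0 < \<gamma> * (v \<bullet> v)" using scalar_prod_self_nonneg[OF v(1)] scalar_prod_self_eq_0[OF v(1)] v(2) \<open>0 < \<gamma>\<close> by simp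
  moreover have "0 \<le> 1 / real r * (\<Sum>j<r. (row A j \<bullet> v) * (row A j \<bullet> v))"
    by (simp add: sum_nonneg)
  ultimately show ?thesis unfolding regularized_gram_form[OF A v(1) v(1)] by linarith
qed

lemma regularized_gram_inverse:
  assumes A: "A \<in> carrier_mat r d" and "0 < \<gamma>"
  obtains B where "mat_inverse (regularized_gram A \<gamma>) = Some B" "B \<in> carrier_mat d d"
    "regularized_gram A \<gamma> * B = 1\<^sub>m d" "B * regularized_gram A \<gamma> = 1\<^sub>m d"
proof (rule mat_inverse_if_inj[of "regularized_gram A \<gamma>" d])
  fix v :: "real vec" assume "v \<in> carrier_vec d" "v \<noteq> 0\<^sub>v d"
  then show "regularized_gram A \<gamma> *\<^sub>v v \<noteq> 0\<^sub>v d" using regularized_gram_pos[OF A \<open>0 < \<gamma>\<close>, of v] by auto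
qed (use A that in auto)

text \<open>\<open>submatrix\<close> lists its rows through \<open>pick\<close>. Counting the
  smaller elements of \<open>I\<close> inverts \<open>pick\<close>, so a sum over the listed rows is
  a sum over samples.\<close>

lemma sum_pick:
  "(\<Sum>r<card {j. j < n \<and> j \<in> I}. f (pick I r)) = (\<Sum>j\<in>{j. j < n \<and> j \<in> I}. f j)"
proof -
  define J where "J = {j. j < n \<and> j \<in> I}"
  define g where "g j = card {a \<in> I. a < j}" for j
  have pg: "pick I (g j) = j" if "j \<in> J" for j
    using that pick_card_in_set[of j I] unfolding g_def J_def by simp
  then have inj: "inj_on g J" by (metis inj_onI)
  have fin: "finite J" unfolding J_def by simp
  have "g ` J \<subseteq> {..<card J}"
  proof safe
    fix j assume j: "j \<in> J"
    then have "{a \<in> I. a < j} \<subset> J" unfolding J_def by auto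
    then show "g j < card J" unfolding g_def by (rule psubset_card_mono[OF fin])
  qed
  then have "g ` J = {..<card J}"
    by (intro card_subset_eq) (auto simp: card_image[OF inj])
  then have "(\<Sum>r<card J. f (pick I r)) = (\<Sum>j\<in>J. f (pick I (g j)))"
    using sum.reindex[OF inj, of "\<lambda>r. f (pick I r)"] by simp
  also have "\<dots> = (\<Sum>j\<in>J. f j)" using pg by (intro sum.cong) auto
  finally show ?thesis unfolding J_def .
qed

lemma worker_matrix_form:
  assumes A: "A \<in> carrier_mat n d" and v: "v \<in> carrier_vec d" and w: "w \<in> carrier_vec d"
    and S: "S = {j. j < n \<and> p j = i}"
  shows "worker_matrix A p i \<in> carrier_mat (card S) d"
    and "v \<bullet> (regularized_gram (worker_matrix A p i) \<gamma> *\<^sub>v w) =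
      1 / real (card S) * (\<Sum>j\<in>S. (row A j \<bullet> v) * (row A j \<bullet> w)) + \<gamma> * (v \<bullet> w)"
proof -
  let ?I = "{j. p j = i}"
  \<comment> \<open>Nothing is assumed about \<open>p\<close> beyond \<open>n\<close>, so
    \<open>?I\<close> may be larger than \<open>S\<close>; the submatrix sees only its elements
    below \<open>n\<close>.\<close>
  have S': "S = {j. j < n \<and> j \<in> ?I}" unfolding S by simp
  show W: "worker_matrix A p i \<in> carrier_mat (card S) d"
    using A unfolding worker_matrix_def S' by (auto simp: dim_submatrix)
  have row: "row (worker_matrix A p i) r = row A (pick ?I r)" if "r < card S" for r
  proof (rule eq_vecI)
    have "pick ?I r < n" using pick_le[of r n ?I] that unfolding S' by simp
    then show "row (worker_matrix A p i) r $ k = row A (pick ?I r) $ k" if "k < dim_vec (row A (pick ?I r))" for k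
      using that \<open>r < card S\<close> W A unfolding worker_matrix_def S'
      by (simp add: submatrix_index dim_submatrix pick_UNIV)
  qed (use W A in auto)
  have "(\<Sum>r<card S. (row (worker_matrix A p i) r \<bullet> v) * (row (worker_matrix A p i) r \<bullet> w))
     = (\<Sum>r<card S. (row A (pick ?I r) \<bullet> v) * (row A (pick ?I r) \<bullet> w))"
    by (intro sum.cong) (auto simp: row)
  also have "\<dots> = (\<Sum>j\<in>S. (row A j \<bullet> v) * (row A j \<bullet> w))"
    unfolding S' by (rule sum_pick)
  finally show "v \<bullet> (regularized_gram (worker_matrix A p i) \<gamma> *\<^sub>v w) =
      1 / real (card S) * (\<Sum>j\<in>S. (row A j \<bullet> v) * (row A j \<bullet> w)) + \<gamma> * (v \<bullet> w)"
    unfolding regularized_gram_form[OF W v w] by simp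
qed

subsection \<open>Averaged Newton steps\<close>

lemma vnorm_nonneg [simp]: "v \<in> carrier_vec d \<Longrightarrow> 0 \<le> vnorm v"
  unfolding vnorm_def using scalar_prod_self_nonneg by simp

lemma vnorm_sq: "v \<in> carrier_vec d \<Longrightarrow> (vnorm v)\<^sup>2 = v \<bullet> v"
  unfolding vnorm_def using scalar_prod_self_nonneg by simp

lemma abs_scalar_prod_le:
  assumes "v \<in> carrier_vec d" "w \<in> carrier_vec d"
  shows "\<bar>v \<bullet> w\<bar> \<le> vnorm v * vnorm w"
  using real_sqrt_le_mono[OF scalar_prod_Cauchy_Schwarz[OF assms]]
  unfolding vnorm_def by (simp add: real_sqrt_mult)

lemma vnorm_diff_le:
  assumes v: "v \<in> carrier_vec d" and w: "w \<in> carrier_vec d"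
  shows "vnorm (v - w) \<le> vnorm v + vnorm w"
proof (rule power2_le_imp_le)
  have "(vnorm (v - w))\<^sup>2 = v \<bullet> v - 2 * (v \<bullet> w) + w \<bullet> w"
    using v w by (simp add: vnorm_sq[of _ d] minus_scalar_prod_distrib[of _ d] scalar_prod_minus_distrib[of _ d]
      comm_scalar_prod[of w d v])
  also have "\<dots> \<le> v \<bullet> v + 2 * (vnorm v * vnorm w) + w \<bullet> w"
    using abs_scalar_prod_le[OF v w] by linarith
  also have "\<dots> = (vnorm v + vnorm w)\<^sup>2"
    using v w by (simp add: power2_sum vnorm_sq[of _ d])
  finally show "(vnorm (v - w))\<^sup>2 \<le> (vnorm v + vnorm w)\<^sup>2" .
qed (use v w in auto)

lemma finsum_vec_carrier [simp]:
  "(\<And>i. i \<in> I \<Longrightarrow> z i \<in> carrier_vec d) \<Longrightarrow> finsum_vec TYPE(real) d z I \<in> carrier_vec d"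
  by (rule finsum_vec_closed) auto

lemma scalar_prod_finsum_vec:
  assumes "finite I" "\<And>i. i \<in> I \<Longrightarrow> z i \<in> carrier_vec d"
  shows "x \<bullet> finsum_vec TYPE(real) d z I = (\<Sum>i\<in>I. x \<bullet> z i)"
proof -
  have "x \<bullet> finsum_vec TYPE(real) d z I = (\<Sum>a<d. \<Sum>i\<in>I. x $ a * z i $ a)"
    using assms by (subst scalar_prod_sum[of _ d]) (auto simp: index_finsum_vec sum_distrib_left)
  also have "\<dots> = (\<Sum>i\<in>I. x \<bullet> z i)"
    using assms by (subst sum.swap) (simp add: scalar_prod_sum[of _ d])
  finally show ?thesis .
qed

text \<open>Since the \<open>Hs i\<close> average to \<open>H\<close>, the first order error cancels and a deviation \<open>\<eta>\<close> costs only
  \<open>\<eta>\<^sup>2\<close>; this is why \<open>1 / \<epsilon>\<close> samples suffice instead of \<open>1 / \<epsilon>\<^sup>2\<close>.\<close>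

lemma averaged_newton_contraction:
  fixes H N :: "real mat" and Hs :: "nat \<Rightarrow> real mat"
  defines "nrm \<equiv> \<lambda>v. vnorm (N *\<^sub>v v)"
  assumes H: "H \<in> carrier_mat d d" and Hs: "\<And>i. i < m \<Longrightarrow> Hs i \<in> carrier_mat d d" and "0 < m" and \<eta>: "0 \<le> \<eta>" "\<eta> < 1"
    and N: "N \<in> carrier_mat D d" "transpose_mat N * N = H"
    and dev: "\<And>i v w. i < m \<Longrightarrow> v \<in> carrier_vec d \<Longrightarrow> w \<in> carrier_vec d \<Longrightarrow>
      \<bar>v \<bullet> (Hs i *\<^sub>v w) - v \<bullet> (H *\<^sub>v w)\<bar> \<le> \<eta> * nrm v * nrm w"
    and avg: "\<And>v w. v \<in> carrier_vec d \<Longrightarrow> w \<in> carrier_vec d \<Longrightarrow> (\<Sum>i<m. v \<bullet> (Hs i *\<^sub>v w)) = real m * (v \<bullet> (H *\<^sub>v w))"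
    and e: "e \<in> carrier_vec d"
    and z: "\<And>i. i < m \<Longrightarrow> z i \<in> carrier_vec d" "\<And>i. i < m \<Longrightarrow> Hs i *\<^sub>v z i = H *\<^sub>v e"
  shows "nrm (e - (1 / real m) \<cdot>\<^sub>v finsum_vec TYPE(real) d z {..<m}) \<le> \<eta>\<^sup>2 / (1 - \<eta>) * nrm e"
proof -
  have nrm0: "0 \<le> nrm v" if "v \<in> carrier_vec d" for v
    unfolding nrm_def using N(1) that by (intro vnorm_nonneg[of _ D]) auto
  have nrm_sq: "nrm v * nrm v = v \<bullet> (H *\<^sub>v v)" if v: "v \<in> carrier_vec d" for v
  proof -
    have Nv: "N *\<^sub>v v \<in> carrier_vec D" using N(1) v by auto
    have NNv: "transpose_mat N *\<^sub>v (N *\<^sub>v v) \<in> carrier_vec d" using N(1) Nv by auto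
    have "v \<bullet> (H *\<^sub>v v) = v \<bullet> (transpose_mat N *\<^sub>v (N *\<^sub>v v))"
      unfolding N(2)[symmetric] using N(1) v by simp
    also have "\<dots> = (N *\<^sub>v v) \<bullet> (N *\<^sub>v v)"
      using transpose_vec_mult_scalar[OF N(1) v Nv] comm_scalar_prod[OF v NNv] by simp
    finally show ?thesis using vnorm_sq[OF Nv] unfolding nrm_def by (simp add: power2_eq_square)
  qed
  \<comment> \<open>The error that would remain if the step of worker \<open>i\<close> were taken
    alone.\<close>
  define r where "r i = e - z i" for i
  have r: "r i \<in> carrier_vec d" if "i < m" for i unfolding r_def using e z that by auto
  have zr: "z i = e - r i" if "i < m" for i using e z(1)[OF that] unfolding r_def by (intro eq_vecI) auto
  have form: "v \<bullet> (H *\<^sub>v r i) = v \<bullet> (Hs i *\<^sub>v z i) - v \<bullet> (H *\<^sub>v z i)" if v: "v \<in> carrier_vec d" and i: "i < m" for v i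
    unfolding z(2)[OF i] unfolding r_def using H e z(1)[OF i] v
    by (simp add: mult_minus_distrib_mat_vec[of _ d d] scalar_prod_minus_distrib[of _ d])
  have cancel: "x \<le> y" if "x * x \<le> y * x" "0 \<le> x" "0 \<le> y" for x y :: real
    using that by (cases "x = 0") (auto simp: mult_le_cancel_right)
  \<comment> \<open>A single worker contracts only by \<open>\<eta> / (1 - \<eta>)\<close>: its
    residual is at most \<open>\<eta>\<close> times the norm of \<open>z i\<close>, which is at most
    that of \<open>e\<close> plus that of the residual.\<close>
  have r_le: "nrm (r i) \<le> \<eta> / (1 - \<eta>) * nrm e" if i: "i < m" for i
  proof -
    have "nrm (r i) * nrm (r i) \<le> \<eta> * nrm (r i) * nrm (z i)"
      unfolding nrm_sq[OF r[OF i]] form[OF r[OF i] i] using dev[OF i r[OF i] z(1)[OF i]] by linarith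
    then have "nrm (r i) * nrm (r i) \<le> \<eta> * nrm (z i) * nrm (r i)" by (simp add: mult_ac)
    then have "nrm (r i) \<le> \<eta> * nrm (z i)"
      by (rule cancel) (use nrm0[OF r[OF i]] nrm0[OF z(1)[OF i]] \<eta> in auto)
    moreover have "nrm (z i) \<le> nrm e + nrm (r i)"
      unfolding nrm_def zr[OF i] using N(1) e r[OF i]
      by (subst mult_minus_distrib_mat_vec[of _ D d]) (auto intro!: vnorm_diff_le[of _ D])
    ultimately have "nrm (r i) \<le> \<eta> * (nrm e + nrm (r i))"
      using \<eta>(1) by (meson mult_left_mono order_trans)
    then show ?thesis using \<eta> by (simp add: field_simps)
  qed
  define zbar where "zbar = (1 / real m) \<cdot>\<^sub>v finsum_vec TYPE(real) d z {..<m}"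
  have fz: "finsum_vec TYPE(real) d z {..<m} \<in> carrier_vec d" by (rule finsum_vec_carrier) (use z(1) in auto)
  then have zbar: "zbar \<in> carrier_vec d" unfolding zbar_def by simp
  have ez: "e - zbar \<in> carrier_vec d" using e zbar by simp
  have formbar: "real m * (v \<bullet> (H *\<^sub>v (e - zbar))) = (\<Sum>i<m. v \<bullet> (H *\<^sub>v r i))" if v: "v \<in> carrier_vec d" for v
  proof -
    define x where "x = transpose_mat H *\<^sub>v v"
    have x: "x \<in> carrier_vec d" unfolding x_def using H v by auto
    have vH: "v \<bullet> (H *\<^sub>v w) = x \<bullet> w" if "w \<in> carrier_vec d" for w
      unfolding x_def using transpose_vec_mult_scalar[OF H that v] by simp
    have "x \<bullet> zbar = (1 / real m) * (\<Sum>i<m. x \<bullet> z i)"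
    proof -
      have "x \<bullet> finsum_vec TYPE(real) d z {..<m} = (\<Sum>i<m. x \<bullet> z i)"
        by (rule scalar_prod_finsum_vec) (use z(1) in auto)
      then show ?thesis unfolding zbar_def using fz x by simp
    qed
    then have "real m * (x \<bullet> (e - zbar)) = real m * (x \<bullet> e) - (\<Sum>i<m. x \<bullet> z i)"
      using x e zbar \<open>0 < m\<close> by (simp add: scalar_prod_minus_distrib[of _ d] right_diff_distrib)
    also have "\<dots> = (\<Sum>i<m. x \<bullet> r i)"
      unfolding r_def using x e z(1) by (simp add: scalar_prod_minus_distrib[of _ d] sum_subtractf)
    finally show ?thesis using vH ez r by simp
  qed
  let ?q = "\<lambda>i v w. v \<bullet> (Hs i *\<^sub>v w) - v \<bullet> (H *\<^sub>v w)"
  have q_diff: "?q i v (z i) = ?q i v e - ?q i v (r i)" if v: "v \<in> carrier_vec d" and i: "i < m" for v i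
    unfolding zr[OF i] using H Hs[OF i] v e r[OF i]
    by (simp add: mult_minus_distrib_mat_vec[of _ d d] scalar_prod_minus_distrib[of _ d])
  define n0 where "n0 = nrm (e - zbar)"
  have "real m * (n0 * n0) = (\<Sum>i<m. ?q i (e - zbar) (z i))"
    unfolding n0_def nrm_sq[OF ez] formbar[OF ez] using form[OF ez] by (intro sum.cong) auto
  \<comment> \<open>Writing \<open>z i\<close> as \<open>e - r i\<close> isolates a first order part
    that averages to zero. Each remaining term has one factor \<open>\<eta>\<close> from the
    deviation and another from \<open>r_le\<close>.\<close>
  also have "\<dots> = (\<Sum>i<m. ?q i (e - zbar) e) - (\<Sum>i<m. ?q i (e - zbar) (r i))"
    unfolding sum_subtractf[symmetric] using q_diff[OF ez] by (intro sum.cong) auto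
  also have "(\<Sum>i<m. ?q i (e - zbar) e) = 0"
    using avg[OF ez e] by (simp add: sum_subtractf)
  also have "0 - (\<Sum>i<m. ?q i (e - zbar) (r i)) \<le> (\<Sum>i<m. \<eta> * n0 * (\<eta> / (1 - \<eta>) * nrm e))"
    unfolding diff_0 sum_negf[symmetric]
  proof (rule sum_mono)
    fix i assume "i \<in> {..<m}"
    then have i: "i < m" by simp
    have "- ?q i (e - zbar) (r i) \<le> \<eta> * n0 * nrm (r i)"
      using dev[OF i ez r[OF i]] unfolding n0_def by linarith
    also have "\<dots> \<le> \<eta> * n0 * (\<eta> / (1 - \<eta>) * nrm e)"
      using r_le[OF i] \<eta> nrm0[OF ez] unfolding n0_def by (intro mult_left_mono) auto
    finally show "- ?q i (e - zbar) (r i) \<le> \<dots>" .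
  qed
  finally have "real m * (n0 * n0) \<le> real m * (\<eta>\<^sup>2 / (1 - \<eta>) * nrm e * n0)"
    by (simp add: power2_eq_square mult_ac)
  then have "n0 * n0 \<le> \<eta>\<^sup>2 / (1 - \<eta>) * nrm e * n0"
    by (rule mult_left_le_imp_le) (use \<open>0 < m\<close> in simp)
  then show ?thesis unfolding zbar_def[symmetric] n0_def[symmetric]
    by (rule cancel) (use nrm0[OF ez] nrm0[OF e] \<eta> in \<open>auto simp: n0_def\<close>)
qed

subsection \<open>The gradient of the objective\<close>

lemma convex_quadratic_deriv:
  assumes "convex_quadratic f"
  obtains a b where "0 \<le> a" "\<And>z. (f has_real_derivative 2 * a * z + b) (at z)" "deriv (deriv f) 0 = 2 * a"
proof -
  obtain a b c where f: "\<And>z. f z = a * z\<^sup>2 + b * z + c" and conv: "convex_on UNIV f"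
    using assms unfolding convex_quadratic_def by blast
  \<comment> \<open>Midpoint convexity between \<open>-1\<close> and \<open>1\<close> yields the
    sign of \<open>a\<close>.\<close>
  have "f ((1 - 1 / 2) *\<^sub>R (- 1) + (1 / 2) *\<^sub>R 1) \<le> (1 - 1 / 2) * f (- 1) + (1 / 2) * f 1"
    by (rule convex_onD[OF conv]) auto
  then have "0 \<le> a" by (simp add: f field_simps)
  moreover have d: "(f has_real_derivative 2 * a * z + b) (at z)" for z
    unfolding f[abs_def] by (auto intro!: derivative_eq_intros)
  moreover have "deriv (deriv f) 0 = 2 * a"
  proof -
    have "deriv f = (\<lambda>z. 2 * a * z + b)" using DERIV_imp_deriv[OF d] by auto
    then show ?thesis by (intro DERIV_imp_deriv) (auto intro!: derivative_eq_intros)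
  qed
  ultimately show ?thesis using that by blast
qed

lemma objective_partial_derivative:
  assumes x: "\<And>j. j < n \<Longrightarrow> x j \<in> carrier_vec d" and w: "w \<in> carrier_vec d" and k: "k < d"
    and l: "\<And>j z. j < n \<Longrightarrow> (l j has_real_derivative g j z) (at z)"
  shows "((\<lambda>t. objective n x l \<gamma> (w + t \<cdot>\<^sub>v unit_vec d k)) has_real_derivative
    1 / real n * (\<Sum>j<n. g j (x j \<bullet> w) * x j $ k) + \<gamma> * w $ k) (at 0)"
proof -
  have u: "unit_vec d k \<in> carrier_vec d" by simp
  have xw: "x j \<bullet> (w + t \<cdot>\<^sub>v unit_vec d k) = x j \<bullet> w + t * x j $ k" if "j < n" for t j
    using x[OF that] w k u by (simp add: scalar_prod_add_distrib[of _ d])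
  have ww: "(vnorm (w + t \<cdot>\<^sub>v unit_vec d k))\<^sup>2 = w \<bullet> w + 2 * t * w $ k + t\<^sup>2" for t
  proof -
    have wt: "w + t \<cdot>\<^sub>v unit_vec d k \<in> carrier_vec d" using w by simp
    have "(vnorm (w + t \<cdot>\<^sub>v unit_vec d k))\<^sup>2 = (w + t \<cdot>\<^sub>v unit_vec d k) \<bullet> (w + t \<cdot>\<^sub>v unit_vec d k)"
      unfolding vnorm_def using scalar_prod_self_nonneg[OF wt] by simp
    also have "\<dots> = w \<bullet> w + 2 * t * w $ k + t\<^sup>2"
      using w k u by (simp add: add_scalar_prod_distrib[of _ d] scalar_prod_add_distrib[of _ d] power2_eq_square algebra_simps)
    finally show ?thesis .
  qed
  have obj: "objective n x l \<gamma> (w + t \<cdot>\<^sub>v unit_vec d k) =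
    1 / real n * (\<Sum>j<n. l j (x j \<bullet> w + t * x j $ k)) + \<gamma> / 2 * (w \<bullet> w + 2 * t * w $ k + t\<^sup>2)" for t
    unfolding objective_def ww by (simp add: xw)
  have "((\<lambda>t. l j (x j \<bullet> w + t * x j $ k)) has_real_derivative g j (x j \<bullet> w) * x j $ k) (at 0)" if "j < n" for j
    by (rule DERIV_chain2[where f = "l j"]) (use l[OF that] in \<open>auto intro!: derivative_eq_intros\<close>)
  then have S: "((\<lambda>t. \<Sum>j<n. l j (x j \<bullet> w + t * x j $ k)) has_real_derivative (\<Sum>j<n. g j (x j \<bullet> w) * x j $ k)) (at 0)"
    by (intro DERIV_sum) auto
  have P: "((\<lambda>t. \<gamma> / 2 * (w \<bullet> w + 2 * t * w $ k + t\<^sup>2)) has_real_derivative \<gamma> * w $ k) (at 0)"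
    by (auto intro!: derivative_eq_intros)
  show ?thesis unfolding obj by (rule DERIV_add[OF DERIV_cmult[OF S] P])
qed

text \<open>The partial derivatives are affine in \<open>w\<close> and vanish at the minimiser, so
  the gradient equals its difference from the one at \<open>wstar\<close>, in which only the
  curvatures remain.\<close>

lemma gradient_objective:
  assumes x: "\<And>j. j < n \<Longrightarrow> x j \<in> carrier_vec d" and l: "\<And>j. j < n \<Longrightarrow> convex_quadratic (l j)"
    and min: "is_arg_min (objective n x l \<gamma>) (\<lambda>w. w \<in> carrier_vec d) wstar"
    and w: "w \<in> carrier_vec d"
  shows "gradient d (objective n x l \<gamma>) w = regularized_gram (data_matrix n d x l) \<gamma> *\<^sub>v (w - wstar)"
proof -
  define A where "A = data_matrix n d x l"
  have A: "A \<in> carrier_mat n d" unfolding A_def data_matrix_def by simp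
  have "\<forall>j. \<exists>a b. j < n \<longrightarrow> 0 \<le> a \<and> (\<forall>z. (l j has_real_derivative 2 * a * z + b) (at z)) \<and> deriv (deriv (l j)) 0 = 2 * a"
    using convex_quadratic_deriv[OF l] by metis
  then obtain a b where ab: "\<And>j. j < n \<Longrightarrow> 0 \<le> a j"
    "\<And>j z. j < n \<Longrightarrow> (l j has_real_derivative 2 * a j * z + b j) (at z)"
    "\<And>j. j < n \<Longrightarrow> deriv (deriv (l j)) 0 = 2 * a j" by metis
  have star: "wstar \<in> carrier_vec d" and le: "\<And>y. y \<in> carrier_vec d \<Longrightarrow> objective n x l \<gamma> wstar \<le> objective n x l \<gamma> y"
    using min unfolding is_arg_min_linorder by auto
  define h where "h v k = 1 / real n * (\<Sum>j<n. (2 * a j * (x j \<bullet> v) + b j) * x j $ k) + \<gamma> * v $ k" for v k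
  have der: "((\<lambda>t. objective n x l \<gamma> (v + t \<cdot>\<^sub>v unit_vec d k)) has_real_derivative h v k) (at 0)"
    if "v \<in> carrier_vec d" "k < d" for v k
    unfolding h_def using objective_partial_derivative[OF x that ab(2)] by simp
  have e: "w - wstar \<in> carrier_vec d" using w star by simp
  show ?thesis unfolding A_def[symmetric]
  proof (rule eq_vecI)
    fix k assume "k < dim_vec (regularized_gram A \<gamma> *\<^sub>v (w - wstar))"
    then have k: "k < d" using regularized_gram_carrier[OF A, of \<gamma>] by simp
    have row: "row A j \<bullet> unit_vec d k = sqrt (2 * a j) * x j $ k"
      "row A j \<bullet> (w - wstar) = sqrt (2 * a j) * (x j \<bullet> w - x j \<bullet> wstar)" if j: "j < n" for j
    proof -
      have "row A j = sqrt (2 * a j) \<cdot>\<^sub>v x j"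
        using j x[OF j] ab(3)[OF j] unfolding A_def data_matrix_def by (intro eq_vecI) auto
      then show "row A j \<bullet> unit_vec d k = sqrt (2 * a j) * x j $ k"
      "row A j \<bullet> (w - wstar) = sqrt (2 * a j) * (x j \<bullet> w - x j \<bullet> wstar)"
        using x[OF j] w star k by (simp_all add: scalar_prod_minus_distrib[of _ d] right_diff_distrib)
    qed
    have w0: "wstar + 0 \<cdot>\<^sub>v unit_vec d k = wstar" using star by (intro eq_vecI) auto
    have "h wstar k = 0"
      by (rule DERIV_local_min[OF der[OF star k], of 1]) (use le star in \<open>auto simp: w0\<close>)
    moreover have "gradient d (objective n x l \<gamma>) w $ k = h w k"
      unfolding gradient_def using k DERIV_imp_deriv[OF der[OF w k]] by simp
    moreover have "(regularized_gram A \<gamma> *\<^sub>v (w - wstar)) $ k = h w k - h wstar k"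
    proof -
      have "(regularized_gram A \<gamma> *\<^sub>v (w - wstar)) $ k = unit_vec d k \<bullet> (regularized_gram A \<gamma> *\<^sub>v (w - wstar))"
        using k e regularized_gram_carrier[OF A, of \<gamma>] by (simp add: scalar_prod_left_unit[of _ d] del: index_mult_mat_vec)
      also have "\<dots> = 1 / real n * (\<Sum>j<n. (row A j \<bullet> unit_vec d k) * (row A j \<bullet> (w - wstar))) + \<gamma> * (unit_vec d k \<bullet> (w - wstar))"
        using e by (intro regularized_gram_form[OF A]) auto
      also have "unit_vec d k \<bullet> (w - wstar) = w $ k - wstar $ k" using k e w star by simp
      also have "(\<Sum>j<n. (row A j \<bullet> unit_vec d k) * (row A j \<bullet> (w - wstar))) =
        (\<Sum>j<n. (2 * a j * (x j \<bullet> w) + b j) * x j $ k) - (\<Sum>j<n. (2 * a j * (x j \<bullet> wstar) + b j) * x j $ k)"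
        unfolding sum_subtractf[symmetric]
      proof (intro sum.cong refl)
        fix j assume "j \<in> {..<n}"
        then have j: "j < n" by simp
        have sq: "sqrt (2 * a j) * sqrt (2 * a j) = 2 * a j" using ab(1)[OF j] by simp
        have "q * y * (q * z) = (q * q) * z * y" for q y z :: real by simp
        from this[of "sqrt (2 * a j)" "x j $ k" "x j \<bullet> w - x j \<bullet> wstar", unfolded sq]
        have "sqrt (2 * a j) * x j $ k * (sqrt (2 * a j) * (x j \<bullet> w - x j \<bullet> wstar)) = 2 * a j * (x j \<bullet> w - x j \<bullet> wstar) * x j $ k" .
        then show "(row A j \<bullet> unit_vec d k) * (row A j \<bullet> (w - wstar)) =
          (2 * a j * (x j \<bullet> w) + b j) * x j $ k - (2 * a j * (x j \<bullet> wstar) + b j) * x j $ k"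
          unfolding row[OF j] by (simp add: algebra_simps)
      qed
      finally show ?thesis unfolding h_def by (simp add: right_diff_distrib)
    qed
    ultimately show "gradient d (objective n x l \<gamma>) w $ k = (regularized_gram A \<gamma> *\<^sub>v (w - wstar)) $ k" by simp
  qed (use regularized_gram_carrier[OF A, of \<gamma>] in \<open>simp add: gradient_def\<close>)
qed

subsection \<open>Convergence of GIANT\<close>

text \<open>Rounding the logarithm \<open>L\<close> up to a positive integer adds at most one when
  \<open>L\<close> is nonnegative. For \<open>e \<ge> 1\<close> and \<open>m \<ge> 2\<close>,
  \<open>L\<close> is at least \<open>ln 2\<close>, so \<open>L + 1 \<le> 3 * L\<close>; for
  \<open>e < 1\<close> it can be small or negative, and the second bound on \<open>s\<close> pays
  for the rounding.\<close>

lemma exists_exponent: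
  fixes r e L s :: real and m :: nat
  assumes "0 \<le> r" "0 \<le> e" "2 \<le> m" "0 < \<delta>" "\<delta> < 1"
    and s: "360 * r * ln (real m * e / \<delta>) \<le> s" and s': "e < 1 \<Longrightarrow> 360 * r \<le> s"
  obtains Q :: nat where "1 \<le> Q" "ln (real m * e / \<delta>) \<le> real Q" "120 * r * real Q \<le> s"
proof -
  define L where "L = ln (real m * e / \<delta>)"
  define Q where "Q = max 1 (nat \<lceil>L\<rceil>)"
  have Q: "1 \<le> Q" "L \<le> real Q" unfolding Q_def by linarith+
  have Q_le: "real Q \<le> max 1 (L + 1)" unfolding Q_def by linarith
  have "120 * r * real Q \<le> s"
  proof (cases "e < 1")
    case True
    have "real Q \<le> 1 \<or> real Q \<le> L + 1" using Q_le by linarith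
    then show ?thesis
    proof
      assume "real Q \<le> 1"
      then have "r * real Q \<le> r * 1" using assms(1) by (intro mult_left_mono)
      then show ?thesis using s'[OF True] assms(1) by linarith
    next
      assume "real Q \<le> L + 1"
      then have "r * real Q \<le> r * (L + 1)" using assms(1) by (intro mult_left_mono)
      then have "120 * r * real Q \<le> 120 * (r * L) + 120 * r" by (simp add: algebra_simps)
      moreover have "360 * (r * L) \<le> s" using s unfolding L_def by simp
      ultimately show ?thesis using s'[OF True] assms(1) by linarith
    qed
  next
    case False
    have "2 * 1 \<le> real m * e" using assms(3) False by (intro mult_mono) auto
    then have "2 \<le> real m * e / \<delta>" using assms(4,5) by (simp add: pos_le_divide_eq)
    then have "ln 2 \<le> L" unfolding L_def by (subst ln_le_cancel_iff) auto
    then have "1 / 2 \<le> L" using ln2_ge_two_thirds by linarith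
    then have "real Q \<le> 3 * L" using Q_le by linarith
    then have "r * real Q \<le> r * (3 * L)" using assms(1) by (intro mult_left_mono)
    then show ?thesis using s unfolding L_def by simp
  qed
  then show ?thesis using that Q unfolding L_def by blast
qed

lemma sum_lessThan_add:
  fixes n d :: nat
  shows "(\<Sum>k<n + d. f k) = (\<Sum>k<n. f k) + (\<Sum>k<d. f (n + k) :: real)"
  by (induction d) (auto simp: add_ac)

text \<open>A rectangular square root of the regularised Gram matrix, obtained by stacking; nothing below needs a
  square one.\<close>

definition gram_root :: "real mat \<Rightarrow> real \<Rightarrow> real mat" where
  "gram_root A \<gamma> = mat (dim_row A + dim_col A) (dim_col A) (\<lambda>(k, a).
     if k < dim_row A then A $$ (k, a) / sqrt (real (dim_row A))
     else if k = dim_row A + a then sqrt \<gamma> else 0)"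

lemma gram_root:
  assumes A: "A \<in> carrier_mat n d" and "0 < n" and "0 \<le> \<gamma>"
  shows "gram_root A \<gamma> \<in> carrier_mat (n + d) d"
    and "transpose_mat (gram_root A \<gamma>) * gram_root A \<gamma> = regularized_gram A \<gamma>"
proof -
  let ?N = "gram_root A \<gamma>"
  show N: "?N \<in> carrier_mat (n + d) d" using A unfolding gram_root_def by simp
  show "transpose_mat ?N * ?N = regularized_gram A \<gamma>"
  proof (rule eq_matI)
    fix a b assume "a < dim_row (regularized_gram A \<gamma>)" "b < dim_col (regularized_gram A \<gamma>)"
    then have ab: "a < d" "b < d" using regularized_gram_carrier[OF A, of \<gamma>] by auto
    have sq: "sqrt (real n) * sqrt (real n) = real n" "sqrt \<gamma> * sqrt \<gamma> = \<gamma>" using assms by auto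
    have "(transpose_mat ?N * ?N) $$ (a, b) = (\<Sum>k<n + d. ?N $$ (k, a) * ?N $$ (k, b))"
      using N ab by (subst index_mult_mat_sum[of _ d "n + d" _ d]) auto
    also have "\<dots> = (\<Sum>k<n. A $$ (k, a) * A $$ (k, b) / real n) + (\<Sum>k<d. if k = a then (if a = b then \<gamma> else 0) else 0)"
      unfolding sum_lessThan_add using A ab sq
      by (intro arg_cong2[where f = "(+)"] sum.cong) (auto simp: gram_root_def)
    also have "\<dots> = 1 / real n * (\<Sum>k<n. A $$ (k, a) * A $$ (k, b)) + (if a = b then \<gamma> else 0)"
      using ab by (simp add: sum_divide_distrib)
    also have "\<dots> = regularized_gram A \<gamma> $$ (a, b)"
    proof -
      have "(transpose_mat A * A) $$ (a, b) = (\<Sum>k<n. A $$ (k, a) * A $$ (k, b))"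
        using A ab by (subst index_mult_mat_sum[of _ d n _ d]) auto
      then show ?thesis using A ab unfolding regularized_gram_def by (simp del: index_mult_mat(1))
    qed
    finally show "(transpose_mat ?N * ?N) $$ (a, b) = regularized_gram A \<gamma> $$ (a, b)" .
  qed (use N regularized_gram_carrier[OF A, of \<gamma>] in auto)
qed

section \<open>The regression problem in \<open>H\<close>-orthonormal coordinates\<close>

locale ridge_regression =
  fixes n d m s :: nat and A :: "real mat" and \<gamma> :: real
  assumes A: "A \<in> carrier_mat n d" and \<gamma>: "0 < \<gamma>" and m_pos: "0 < m" and s_pos: "0 < s" and n_eq: "n = m * s"
begin

abbreviation "H \<equiv> regularized_gram A \<gamma>"
abbreviation "N \<equiv> gram_root A \<gamma>"

definition "H_inv = the (mat_inverse H)"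

lemma n_pos: "0 < n" using m_pos s_pos n_eq by simp

lemma H_inv: "H_inv \<in> carrier_mat d d" "H * H_inv = 1\<^sub>m d" "H_inv * H = 1\<^sub>m d"
  unfolding H_inv_def by (rule regularized_gram_inverse[OF A \<gamma>], simp)+

lemmas H_carrier [simp] = regularized_gram_carrier[OF A, of \<gamma>]
lemmas H_sym = symmetric_regularized_gram[OF A, of \<gamma>]
lemmas N = gram_root[OF A n_pos less_imp_le[OF \<gamma>]]

lemma N_prod: "v \<in> carrier_vec d \<Longrightarrow> w \<in> carrier_vec d \<Longrightarrow> (N *\<^sub>v v) \<bullet> (N *\<^sub>v w) = v \<bullet> (H *\<^sub>v w)"
proof -
  assume v: "v \<in> carrier_vec d" and w: "w \<in> carrier_vec d"
  have Nv: "N *\<^sub>v v \<in> carrier_vec (n + d)" and Nw: "N *\<^sub>v w \<in> carrier_vec (n + d)" using N(1) v w by auto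
  have NNw: "transpose_mat N *\<^sub>v (N *\<^sub>v w) \<in> carrier_vec d" using N(1) Nw by auto
  have "(N *\<^sub>v v) \<bullet> (N *\<^sub>v w) = (transpose_mat N *\<^sub>v (N *\<^sub>v w)) \<bullet> v"
    using transpose_vec_mult_scalar[OF N(1) v Nw] comm_scalar_prod[OF Nv Nw] by simp
  also have "\<dots> = v \<bullet> (transpose_mat N *\<^sub>v (N *\<^sub>v w))" using NNw v by (rule comm_scalar_prod)
  also have "transpose_mat N *\<^sub>v (N *\<^sub>v w) = H *\<^sub>v w"
    unfolding N(2)[symmetric] using N(1) w by (intro assoc_mult_mat_vec[symmetric]) auto
  finally show ?thesis .
qed

text \<open>As the square of \<open>N\<close> in the sense of \<open>gram_root\<close> is
  \<open>H\<close>, this plays the role of the inverse square root of \<open>H\<close> applied to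
  the row: pairing with \<open>N *\<^sub>v v\<close> gives back
  \<open>row A j \<bullet> v\<close>.\<close>

definition "u j = N *\<^sub>v (H_inv *\<^sub>v row A j)"

lemma row_A [simp]: "j < n \<Longrightarrow> row A j \<in> carrier_vec d" using A by auto

lemma H_inv_row [simp]: "j < n \<Longrightarrow> H_inv *\<^sub>v row A j \<in> carrier_vec d" using H_inv(1) by auto

lemma H_H_inv_row: "j < n \<Longrightarrow> H *\<^sub>v (H_inv *\<^sub>v row A j) = row A j"
  using H_inv by (simp flip: assoc_mult_mat_vec[OF H_carrier H_inv(1)])

lemma H_inv_form: "j < n \<Longrightarrow> v \<in> carrier_vec d \<Longrightarrow> (H_inv *\<^sub>v row A j) \<bullet> (H *\<^sub>v v) = row A j \<bullet> v"
  using symmetric_scalar_prod[OF H_sym, of "H_inv *\<^sub>v row A j" v] by (simp add: H_H_inv_row)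

lemma u_carrier [simp]: "j < n \<Longrightarrow> u j \<in> carrier_vec (n + d)"
  unfolding u_def using N(1) by auto

lemma u_N: "j < n \<Longrightarrow> v \<in> carrier_vec d \<Longrightarrow> u j \<bullet> (N *\<^sub>v v) = row A j \<bullet> v"
  unfolding u_def by (simp add: N_prod H_inv_form)

lemma u_u: "j < n \<Longrightarrow> u j \<bullet> u j = row A j \<bullet> (H_inv *\<^sub>v row A j)"
  by (subst (2) u_def) (simp add: u_N)

text \<open>The matrix inside the leverage score is \<open>n\<close> times \<open>H\<close>, so its
  pseudoinverse is \<open>H_inv / n\<close>.\<close>

lemma leverage_u: "j < n \<Longrightarrow> ridge_leverage A \<gamma> j = u j \<bullet> u j / real n"
proof -
  assume j: "j < n"
  define M where "M = transpose_mat A * A + (real n * \<gamma>) \<cdot>\<^sub>m 1\<^sub>m d"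
  have "M = real n \<cdot>\<^sub>m H"
    unfolding M_def regularized_gram_def using A n_pos by (intro eq_matI) (auto simp: field_simps)
  then have M: "M \<in> carrier_mat d d" "M * ((1 / real n) \<cdot>\<^sub>m H_inv) = 1\<^sub>m d" "(1 / real n) \<cdot>\<^sub>m H_inv * M = 1\<^sub>m d"
    using H_inv n_pos by (auto simp: mult_smult_distrib[of _ d d _ d] mult_smult_assoc_mat[of _ d d _ d] intro!: eq_matI)
  have "pseudoinverse M = (1 / real n) \<cdot>\<^sub>m H_inv"
    by (rule pseudoinverse_eq[OF M(1) _ M(2,3)]) (use H_inv in simp)
  then have "ridge_leverage A \<gamma> j = row A j \<bullet> ((1 / real n) \<cdot>\<^sub>v (H_inv *\<^sub>v row A j))"
    unfolding ridge_leverage_def using A M_def j H_inv(1) by (simp add: smult_mat_mult_vec[of _ d d])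
  also have "\<dots> = u j \<bullet> u j / real n"
    using scalar_prod_smult_distrib[OF row_A[OF j] H_inv_row[OF j], of "1 / real n"] by (simp add: u_u[OF j])
  finally show ?thesis .
qed

abbreviation "deff \<equiv> effective_dim A \<gamma>"

lemma sum_u: "(\<Sum>j<n. u j \<bullet> u j) = real n * deff"
  unfolding effective_dim_def using A n_pos by (simp add: leverage_u flip: sum_divide_distrib)

lemma u_nonneg: "j < n \<Longrightarrow> 0 \<le> u j \<bullet> u j"
  using scalar_prod_self_nonneg[OF u_carrier] .

lemma deff_nonneg: "0 \<le> deff"
proof -
  have "0 \<le> real n * deff" unfolding sum_u[symmetric] by (intro sum_nonneg) (simp add: u_nonneg)
  then show ?thesis using n_pos by (simp add: zero_le_mult_iff)
qed

lemma u_le: "j < n \<Longrightarrow> u j \<bullet> u j \<le> ridge_coherence A \<gamma> * deff"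
proof (cases "deff = 0")
  \<comment> \<open>Here the coherence divides by zero, but all \<open>u j\<close> vanish.\<close>
  case True
  moreover assume "j < n"
  ultimately have "u j \<bullet> u j = 0"
    using sum_u u_nonneg sum_nonneg_eq_0_iff[of "{..<n}" "\<lambda>j. u j \<bullet> u j"] by auto
  then show ?thesis using True by simp
next
  case False
  assume j: "j < n"
  have "ridge_leverage A \<gamma> j \<le> Max (ridge_leverage A \<gamma> ` {..<n})" using j by (intro Max_ge) auto
  then have "real n * ridge_leverage A \<gamma> j \<le> real n * Max (ridge_leverage A \<gamma> ` {..<n})"
    by (intro mult_left_mono) auto
  moreover have "u j \<bullet> u j = real n * ridge_leverage A \<gamma> j" using n_pos by (simp add: leverage_u[OF j])
  ultimately have "u j \<bullet> u j \<le> real n * Max (ridge_leverage A \<gamma> ` {..<n})" by simp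
  then show ?thesis using A False unfolding ridge_coherence_def by simp
qed

text \<open>With \<open>v\<close> as below, \<open>N *\<^sub>v v\<close> is the orthogonal
  projection of \<open>y\<close> onto the range of \<open>N\<close>, so its squared norm, the form
  of \<open>H\<close> at \<open>v\<close>, is at most \<open>y \<bullet> y\<close>. The frame sum is
  \<open>n\<close> times the data part of this form; the ridge part is nonnegative.\<close>

lemma u_frame:
  assumes y: "y \<in> carrier_vec (n + d)"
  shows "(\<Sum>j<n. (u j \<bullet> y)\<^sup>2) \<le> real n * (y \<bullet> y)"
proof -
  define g where "g = transpose_mat N *\<^sub>v y"
  define v where "v = H_inv *\<^sub>v g"
  have g: "g \<in> carrier_vec d" unfolding g_def using N(1) y by auto
  have v: "v \<in> carrier_vec d" unfolding v_def using H_inv(1) g by auto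
  have Nv: "N *\<^sub>v v \<in> carrier_vec (n + d)" using N(1) v by auto
  have Hv: "H *\<^sub>v v = g"
    unfolding v_def using H_inv g by (simp flip: assoc_mult_mat_vec[OF H_carrier H_inv(1)])
  have Ny: "(N *\<^sub>v w) \<bullet> y = w \<bullet> g" if w: "w \<in> carrier_vec d" for w
    using transpose_vec_mult_scalar[OF N(1) w y] comm_scalar_prod[OF g w]
      comm_scalar_prod[of "N *\<^sub>v w" "n + d" y] N(1) w y unfolding g_def by auto
  have uy: "u j \<bullet> y = row A j \<bullet> v" if "j < n" for j
    using that H_inv_form[OF that v] unfolding Hv by (simp add: u_def Ny)
  have "v \<bullet> (H *\<^sub>v v) = (1 / real n) * (\<Sum>j<n. (u j \<bullet> y)\<^sup>2) + \<gamma> * (v \<bullet> v)"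
    unfolding regularized_gram_form[OF A v v] by (simp add: uy power2_eq_square)
  moreover have "0 \<le> \<gamma> * (v \<bullet> v)" using \<gamma> scalar_prod_self_nonneg[OF v] by simp
  moreover have "v \<bullet> (H *\<^sub>v v) \<le> y \<bullet> y"
  proof -
    have "(N *\<^sub>v v) \<bullet> y = v \<bullet> (H *\<^sub>v v)" unfolding Ny[OF v] Hv ..
    then show ?thesis using scalar_prod_le_squares[OF Nv y] N_prod[OF v v] by linarith
  qed
  ultimately have "(1 / real n) * (\<Sum>j<n. (u j \<bullet> y)\<^sup>2) \<le> y \<bullet> y" by linarith
  then show ?thesis using n_pos by (simp add: field_simps)
qed

lemma frame_sampling:
  assumes "i < m"
  shows "frame_sampling n m s i (n + d) u (ridge_coherence A \<gamma> * deff) deff"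
  by unfold_locales (use assms n_eq s_pos u_le u_frame sum_u u_carrier in blast)+

section \<open>Closeness of the worker matrices to \<open>H\<close>\<close>

definition nrm :: "real vec \<Rightarrow> real" where "nrm v = vnorm (N *\<^sub>v v)"

definition Hs :: "(nat \<Rightarrow> nat) \<Rightarrow> nat \<Rightarrow> real mat" where
  "Hs p i = regularized_gram (worker_matrix A p i) \<gamma>"

text \<open>Stated for the bilinear form, because \<open>averaged_newton_contraction\<close>
  evaluates the deviation at two different vectors.\<close>

definition close :: "real \<Rightarrow> (nat \<Rightarrow> nat) \<Rightarrow> nat \<Rightarrow> bool" where
  "close \<eta> p i \<longleftrightarrow> (\<forall>v\<in>carrier_vec d. \<forall>w\<in>carrier_vec d.
     \<bar>v \<bullet> (Hs p i *\<^sub>v w) - v \<bullet> (H *\<^sub>v w)\<bar> \<le> \<eta> * nrm v * nrm w)"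

lemma worker_carrier:
  assumes "p \<in> balanced_assignments n m" "i < m"
  shows "worker_matrix A p i \<in> carrier_mat s d"
proof -
  have "card {j. j < n \<and> p j = i} = s" using assms m_pos n_eq unfolding balanced_assignments_def by auto
  then show ?thesis using worker_matrix_form(1)[OF A zero_carrier_vec zero_carrier_vec refl, of p i] by simp
qed

lemma Hs_form:
  assumes p: "p \<in> balanced_assignments n m" and i: "i < m" and v: "v \<in> carrier_vec d" and w: "w \<in> carrier_vec d"
  shows "v \<bullet> (Hs p i *\<^sub>v w) =
    1 / real s * (\<Sum>j\<in>{j. j < n \<and> p j = i}. (row A j \<bullet> v) * (row A j \<bullet> w)) + \<gamma> * (v \<bullet> w)"
proof -
  have "card {j. j < n \<and> p j = i} = s" using p i m_pos n_eq unfolding balanced_assignments_def by auto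
  then show ?thesis unfolding Hs_def using worker_matrix_form(2)[OF A v w refl, of p i] by simp
qed

text \<open>Every sample belongs to exactly one worker, and all workers weight their samples by the
  same \<open>1 / s\<close>.\<close>

lemma Hs_avg:
  assumes p: "p \<in> balanced_assignments n m" and v: "v \<in> carrier_vec d" and w: "w \<in> carrier_vec d"
  shows "(\<Sum>i<m. v \<bullet> (Hs p i *\<^sub>v w)) = real m * (v \<bullet> (H *\<^sub>v w))"
proof -
  let ?f = "\<lambda>j. (row A j \<bullet> v) * (row A j \<bullet> w)"
  have "p ` {..<n} \<subseteq> {..<m}" using p unfolding balanced_assignments_def by auto
  then have "(\<Sum>i<m. \<Sum>j\<in>{j \<in> {..<n}. p j = i}. ?f j) = (\<Sum>j<n. ?f j)"
    by (intro sum.group) auto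
  then have "(\<Sum>i<m. v \<bullet> (Hs p i *\<^sub>v w)) = 1 / real s * (\<Sum>j<n. ?f j) + real m * (\<gamma> * (v \<bullet> w))"
    by (simp add: Hs_form[OF p _ v w] sum.distrib flip: sum_divide_distrib)
  also have "1 / real s = real m * (1 / real n)" using n_eq m_pos s_pos by simp
  finally show ?thesis unfolding regularized_gram_form[OF A v w] by (simp only: distrib_left mult.assoc)
qed

lemma Hs_diff:
  assumes p: "p \<in> balanced_assignments n m" and i: "i < m" and v: "v \<in> carrier_vec d" and w: "w \<in> carrier_vec d"
  shows "v \<bullet> (Hs p i *\<^sub>v w) - v \<bullet> (H *\<^sub>v w) =
    1 / real s * (\<Sum>j<n. balanced_sampling.chi n s i p j * ((row A j \<bullet> v) * (row A j \<bullet> w)))"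
proof -
  interpret balanced_sampling n m s i by unfold_locales (use i n_eq s_pos in auto)
  show ?thesis unfolding Hs_form[OF p i v w] regularized_gram_form[OF A v w] sum_chi picked_def
    using s_pos n_pos by (simp add: right_diff_distrib)
qed

lemma nrm_nonneg: "v \<in> carrier_vec d \<Longrightarrow> 0 \<le> nrm v"
  unfolding nrm_def using N(1) by (intro vnorm_nonneg[of _ "n + d"]) auto

text \<open>In the coordinates given by \<open>N\<close>, the deviation of \<open>Hs p i\<close>
  from \<open>H\<close> is the form of \<open>X p\<close> divided by \<open>s\<close>, so an
  operator bound on \<open>X p\<close> and Cauchy-Schwarz suffice.\<close>

lemma close_if_small_deviation:
  assumes p: "p \<in> balanced_assignments n m" and i: "i < m" and "0 \<le> \<eta>"
    and dev: "\<And>y. y \<in> carrier_vec (n + d) \<Longrightarrow>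
      (frame_sampling.X n s i (n + d) u p *\<^sub>v y) \<bullet> (frame_sampling.X n s i (n + d) u p *\<^sub>v y) \<le> (real s * \<eta>)\<^sup>2 * (y \<bullet> y)"
  shows "close \<eta> p i"
  unfolding close_def
proof (intro ballI)
  fix v w :: "real vec" assume v: "v \<in> carrier_vec d" and w: "w \<in> carrier_vec d"
  interpret frame_sampling n m s i "n + d" u "ridge_coherence A \<gamma> * deff" deff by (rule frame_sampling[OF i])
  have Nv: "N *\<^sub>v v \<in> carrier_vec (n + d)" and Nw: "N *\<^sub>v w \<in> carrier_vec (n + d)" using N(1) v w by auto
  have XNw: "X p *\<^sub>v (N *\<^sub>v w) \<in> carrier_vec (n + d)" using Nw X_carrier by (rule mult_mat_vec_carrier[rotated])
  have "v \<bullet> (Hs p i *\<^sub>v w) - v \<bullet> (H *\<^sub>v w) = 1 / real s * ((N *\<^sub>v v) \<bullet> (X p *\<^sub>v (N *\<^sub>v w)))"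
  proof -
    have "(N *\<^sub>v v) \<bullet> (X p *\<^sub>v (N *\<^sub>v w)) = (\<Sum>j<n. chi p j * ((u j \<bullet> (N *\<^sub>v v)) * (u j \<bullet> (N *\<^sub>v w))))"
      unfolding X_def by (rule wgram_form) (use u_carrier Nv Nw in auto)
    also have "\<dots> = (\<Sum>j<n. chi p j * ((row A j \<bullet> v) * (row A j \<bullet> w)))"
      using v w by (intro sum.cong refl) (simp add: u_N)
    finally show ?thesis unfolding Hs_diff[OF p i v w] by simp
  qed
  then have "\<bar>v \<bullet> (Hs p i *\<^sub>v w) - v \<bullet> (H *\<^sub>v w)\<bar> = 1 / real s * \<bar>(N *\<^sub>v v) \<bullet> (X p *\<^sub>v (N *\<^sub>v w))\<bar>"
    using s_pos by (simp add: abs_mult)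
  also have "\<dots> \<le> 1 / real s * (nrm v * vnorm (X p *\<^sub>v (N *\<^sub>v w)))"
    unfolding nrm_def using abs_scalar_prod_le[OF Nv XNw] by (intro mult_left_mono) auto
  also have "\<dots> \<le> 1 / real s * (nrm v * (real s * \<eta> * nrm w))"
  proof (intro mult_left_mono)
    show "vnorm (X p *\<^sub>v (N *\<^sub>v w)) \<le> real s * \<eta> * nrm w"
      using real_sqrt_le_mono[OF dev[OF Nw]] \<open>0 \<le> \<eta>\<close> unfolding vnorm_def nrm_def by (simp add: real_sqrt_mult)
  qed (use nrm_nonneg[OF v] in auto)
  also have "\<dots> = \<eta> * nrm v * nrm w" using s_pos by simp
  finally show "\<bar>v \<bullet> (Hs p i *\<^sub>v w) - v \<bullet> (H *\<^sub>v w)\<bar> \<le> \<eta> * nrm v * nrm w" .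
qed

text \<open>For \<open>m = 1\<close> the logarithm in the sample size bound can be arbitrarily close to \<open>0\<close>, so this case is not
  covered by the moment bound.\<close>

lemma close_single_worker:
  assumes p: "p \<in> balanced_assignments n m" and "m = 1" "i < m" "0 \<le> \<eta>"
  shows "close \<eta> p i"
  unfolding close_def
proof (intro ballI)
  fix v w :: "real vec" assume v: "v \<in> carrier_vec d" and w: "w \<in> carrier_vec d"
  have "v \<bullet> (Hs p i *\<^sub>v w) = v \<bullet> (H *\<^sub>v w)"
    using Hs_avg[OF p v w] assms by simp
  then show "\<bar>v \<bullet> (Hs p i *\<^sub>v w) - v \<bullet> (H *\<^sub>v w)\<bar> \<le> \<eta> * nrm v * nrm w"
    using nrm_nonneg[OF v] nrm_nonneg[OF w] \<open>0 \<le> \<eta>\<close> by simp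
qed

text \<open>The tail bound at \<open>\<rho> = s * sqrt (\<epsilon> / 2)\<close>. The factor
  \<open>120\<close> is chosen to make the base of the power at most \<open>1 / 3\<close>, hence at
  most \<open>exp (- 1)\<close>.\<close>

lemma card_not_close_le:
  assumes i: "i < m" and \<epsilon>: "0 < \<epsilon>" "\<epsilon> \<le> 1" and Q: "1 \<le> Q" "120 * (ridge_coherence A \<gamma> * deff / \<epsilon>) * real Q \<le> real s"
  shows "real (card {p \<in> balanced_assignments n m. \<not> close (sqrt (\<epsilon> / 2)) p i})
    \<le> exp (- real Q) * deff * real (card (balanced_assignments n m))"
proof -
  interpret frame_sampling n m s i "n + d" u "ridge_coherence A \<gamma> * deff" deff by (rule frame_sampling[OF i])
  define R where "R = ridge_coherence A \<gamma> * deff"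
  define \<rho> where "\<rho> = real s * sqrt (\<epsilon> / 2)"
  have \<rho>: "0 < \<rho>" "\<rho>\<^sup>2 = (real s)\<^sup>2 * \<epsilon> / 2" unfolding \<rho>_def using s_pos \<epsilon> by (auto simp: power_mult_distrib)
  have R0: "0 \<le> R" unfolding R_def by (rule R_nonneg)
  have Qs: "120 * R * real Q \<le> real s * \<epsilon>" using Q(2) \<epsilon> unfolding R_def[symmetric] by (simp add: field_simps)
  have "real s * \<epsilon> \<le> real s" using \<epsilon> by (simp add: mult_left_le)
  moreover have "4 * R * real Q \<le> 120 * R * real Q" using R0 by (simp add: mult_right_mono)
  ultimately have small: "4 * R * real Q \<le> real s" using Qs by linarith
  have "{p \<in> balanced_assignments n m. \<not> close (sqrt (\<epsilon> / 2)) p i} \<subseteq>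
     {p \<in> \<B>. \<exists>y\<in>carrier_vec (n + d). \<rho>\<^sup>2 * (y \<bullet> y) < (X p *\<^sub>v y) \<bullet> (X p *\<^sub>v y)}" (is "?bad \<subseteq> ?dev")
    using close_if_small_deviation[OF _ i, of _ "sqrt (\<epsilon> / 2)"] \<epsilon>(1) unfolding \<rho>_def by (auto simp: not_less) (meson not_less)
  then have "real (card ?bad) \<le> real (card ?dev)"
    using finite_B by (intro of_nat_mono card_mono) auto
  also have "\<dots> \<le> (20 * R * real Q * real s / \<rho>\<^sup>2) ^ Q * deff * real (card \<B>)"
    unfolding R_def by (rule card_deviation_le[OF \<rho>(1) small[unfolded R_def] Q(1)])
  also have "\<dots> \<le> exp (- 1) ^ Q * deff * real (card \<B>)"
  proof (intro mult_right_mono power_mono)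
    have "20 * R * real Q * real s / \<rho>\<^sup>2 = 40 * R * real Q / (real s * \<epsilon>)"
      unfolding \<rho>(2) using s_pos \<epsilon> by (simp add: power2_eq_square)
    also have "\<dots> \<le> 1 / 3" using Qs s_pos \<epsilon> by (simp add: divide_le_eq)
    also have "\<dots> \<le> exp (- 1)" using exp_le by (simp add: exp_minus field_simps)
    finally show "20 * R * real Q * real s / \<rho>\<^sup>2 \<le> exp (- 1)" .
  qed (use R0 deff_nonneg in auto)
  also have "exp (- 1) ^ Q = exp (- real Q)" by (simp flip: exp_of_nat_mult)
  finally show ?thesis .
qed

lemma giant_step_contraction:
  assumes p: "p \<in> balanced_assignments n m" and good: "\<And>i. i < m \<Longrightarrow> close (sqrt (\<epsilon> / 2)) p i"
    and \<epsilon>: "0 < \<epsilon>" "\<epsilon> < 1 / 4" and e: "e \<in> carrier_vec d"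
    and z: "\<And>i. i < m \<Longrightarrow> z i = the (mat_inverse (Hs p i)) *\<^sub>v (H *\<^sub>v e)"
  shows "nrm (e - (1 / real m) \<cdot>\<^sub>v finsum_vec TYPE(real) d z {..<m}) \<le> \<epsilon> * nrm e"
    and "\<And>i. i < m \<Longrightarrow> z i \<in> carrier_vec d"
proof -
  define \<eta> where "\<eta> = sqrt (\<epsilon> / 2)"
  have He: "H *\<^sub>v e \<in> carrier_vec d" using e H_carrier by (rule mult_mat_vec_carrier[rotated])
  have \<eta>: "0 \<le> \<eta>" "\<eta>\<^sup>2 = \<epsilon> / 2" using \<epsilon> unfolding \<eta>_def by auto
  have "\<eta> \<le> 1 / 2" by (rule power2_le_imp_le) (use \<epsilon> \<eta> in \<open>auto simp: power2_eq_square\<close>)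
  have Hs: "Hs p i \<in> carrier_mat d d" if "i < m" for i
    unfolding Hs_def using regularized_gram_carrier[OF worker_carrier[OF p that]] .
  have inv: "z i \<in> carrier_vec d \<and> Hs p i *\<^sub>v z i = H *\<^sub>v e" if i: "i < m" for i
  proof -
    obtain B where B: "mat_inverse (Hs p i) = Some B" "B \<in> carrier_mat d d" "Hs p i * B = 1\<^sub>m d"
      unfolding Hs_def using regularized_gram_inverse[OF worker_carrier[OF p i] \<gamma>] by metis
    then show ?thesis using z[OF i] He Hs[OF i] by (simp flip: assoc_mult_mat_vec[of _ d d _ d])
  qed
  then show "z i \<in> carrier_vec d" if "i < m" for i using that by blast
  have "nrm (e - (1 / real m) \<cdot>\<^sub>v finsum_vec TYPE(real) d z {..<m}) \<le> \<eta>\<^sup>2 / (1 - \<eta>) * nrm e"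
    unfolding nrm_def
  proof (rule averaged_newton_contraction[OF H_carrier Hs m_pos \<eta>(1) _ N])
    show "\<eta> < 1" using \<open>\<eta> \<le> 1 / 2\<close> by simp
    fix i and v w :: "real vec" assume "i < m" "v \<in> carrier_vec d" "w \<in> carrier_vec d"
    then show "\<bar>v \<bullet> (Hs p i *\<^sub>v w) - v \<bullet> (H *\<^sub>v w)\<bar> \<le> \<eta> * vnorm (N *\<^sub>v v) * vnorm (N *\<^sub>v w)"
      using good unfolding close_def \<eta>_def nrm_def by blast
  next
    fix v w :: "real vec" assume "v \<in> carrier_vec d" "w \<in> carrier_vec d"
    then show "(\<Sum>i<m. v \<bullet> (Hs p i *\<^sub>v w)) = real m * (v \<bullet> (H *\<^sub>v w))" by (rule Hs_avg[OF p])
  qed (use e inv in auto)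
  also have "\<dots> \<le> \<epsilon> * nrm e"
  proof (intro mult_right_mono nrm_nonneg[OF e])
    \<comment> \<open>Since \<open>\<eta> \<le> 1 / 2\<close>, the rate is at most
      \<open>2 * \<eta>\<^sup>2 = \<epsilon>\<close>.\<close>
    have "\<epsilon> * (1 / 2) \<le> \<epsilon> * (1 - \<eta>)" using \<open>\<eta> \<le> 1 / 2\<close> \<epsilon> by (intro mult_left_mono) auto
    then show "\<eta>\<^sup>2 / (1 - \<eta>) \<le> \<epsilon>" unfolding \<eta>(2) using \<open>\<eta> \<le> 1 / 2\<close> by (subst pos_divide_le_eq) auto
  qed
  finally show "nrm (e - (1 / real m) \<cdot>\<^sub>v finsum_vec TYPE(real) d z {..<m}) \<le> \<epsilon> * nrm e" .
qed

text \<open>The contraction is iterated in the norm of \<open>H\<close> and compared with the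
  Euclidean norm only at the two ends, so the condition number enters once and not in every
  step.\<close>

lemma giant_convergence:
  assumes p: "p \<in> balanced_assignments n m" and good: "\<And>i. i < m \<Longrightarrow> close (sqrt (\<epsilon> / 2)) p i"
    and \<epsilon>: "0 < \<epsilon>" "\<epsilon> < 1 / 4" and "0 < d" and w0: "w0 \<in> carrier_vec d" and star: "wstar \<in> carrier_vec d"
    and grad: "\<And>w. w \<in> carrier_vec d \<Longrightarrow> gradient d F w = H *\<^sub>v (w - wstar)"
  shows "vnorm (giant_iterate d m F A \<gamma> p w0 t - wstar) \<le> \<epsilon> ^ t * sqrt (sigma_max H / sigma_min H) * vnorm (w0 - wstar)"
proof -
  let ?w = "giant_iterate d m F A \<gamma> p w0"
  have iter: "?w t \<in> carrier_vec d \<and> nrm (?w t - wstar) \<le> \<epsilon> ^ t * nrm (w0 - wstar)" for t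
  proof (induction t)
    case (Suc t)
    define e where "e = ?w t - wstar"
    define z where "z i = the (mat_inverse (Hs p i)) *\<^sub>v (H *\<^sub>v e)" for i
    have e: "e \<in> carrier_vec d" unfolding e_def using Suc star by simp
    have zc: "z i \<in> carrier_vec d" if "i < m" for i
      by (rule giant_step_contraction(2)[OF p good \<epsilon> e _ that]) (auto simp: z_def)
    have contr: "nrm (e - (1 / real m) \<cdot>\<^sub>v finsum_vec TYPE(real) d z {..<m}) \<le> \<epsilon> * nrm e"
      by (rule giant_step_contraction(1)[OF p good \<epsilon> e]) (auto simp: z_def)
    have fz: "finsum_vec TYPE(real) d z {..<m} \<in> carrier_vec d" by (rule finsum_vec_carrier) (use zc in auto)
    have "gradient d F (?w t) = H *\<^sub>v e" unfolding e_def using grad Suc by simp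
    then have step: "?w (Suc t) = ?w t - (1 / real m) \<cdot>\<^sub>v finsum_vec TYPE(real) d z {..<m}"
      by (simp add: z_def[abs_def] Hs_def)
    have "?w (Suc t) - wstar = e - (1 / real m) \<cdot>\<^sub>v finsum_vec TYPE(real) d z {..<m}"
      unfolding step e_def using Suc star fz by (intro eq_vecI) auto
    then have "nrm (?w (Suc t) - wstar) \<le> \<epsilon> * nrm (?w t - wstar)" using contr unfolding e_def by simp
    also have "\<dots> \<le> \<epsilon> * (\<epsilon> ^ t * nrm (w0 - wstar))" using Suc \<epsilon> by (intro mult_left_mono) auto
    finally show ?case using Suc fz unfolding step by simp
  qed (use w0 in simp)
  let ?d = "w0 - wstar" and ?e = "?w t - wstar"
  have e0: "?d \<in> carrier_vec d" and e: "?e \<in> carrier_vec d" using w0 star iter by auto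
  have nrm_eq: "nrm v = sqrt (v \<bullet> (H *\<^sub>v v))" if "v \<in> carrier_vec d" for v
    unfolding nrm_def vnorm_def N_prod[OF that that] ..
  have sigma: "0 < sigma_min H" "sigma_min H * (?e \<bullet> ?e) \<le> ?e \<bullet> (H *\<^sub>v ?e)"
    "?d \<bullet> (H *\<^sub>v ?d) \<le> sigma_max H * (?d \<bullet> ?d)"
    using sigma_bounds[OF H_sym \<open>0 < d\<close>] regularized_gram_pos[OF A \<gamma>] e e0 by blast+
  have "sqrt (sigma_min H) * vnorm ?e \<le> nrm ?e"
    unfolding nrm_eq[OF e] vnorm_def real_sqrt_mult[symmetric] using sigma(2) by simp
  also have "\<dots> \<le> \<epsilon> ^ t * nrm ?d" using iter by blast
  also have "\<dots> \<le> \<epsilon> ^ t * (sqrt (sigma_max H) * vnorm ?d)"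
    unfolding nrm_eq[OF e0] vnorm_def real_sqrt_mult[symmetric] using sigma(3) \<epsilon> by (intro mult_left_mono) auto
  finally show ?thesis using sigma(1) by (simp add: real_sqrt_divide field_simps)
qed

lemma giant_probability:
  assumes \<epsilon>: "0 < \<epsilon>" "\<epsilon> < 1 / 4" and \<delta>: "0 < \<delta>" "\<delta> < 1" and "0 < d" and w0: "w0 \<in> carrier_vec d" and star: "wstar \<in> carrier_vec d"
    and grad: "\<And>w. w \<in> carrier_vec d \<Longrightarrow> gradient d F w = H *\<^sub>v (w - wstar)"
    and s: "360 * (ridge_coherence A \<gamma> * deff / \<epsilon>) * ln (real m * deff / \<delta>) \<le> real s"
    and s': "deff < 1 \<Longrightarrow> 360 * (ridge_coherence A \<gamma> * deff / \<epsilon>) \<le> real s"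
  shows "1 - \<delta> \<le> measure_pmf.prob (pmf_of_set (balanced_assignments n m))
    {p. \<forall>t. vnorm (giant_iterate d m F A \<gamma> p w0 t - wstar)
       \<le> \<epsilon> ^ t * sqrt (sigma_max H / sigma_min H) * vnorm (w0 - wstar)}" (is "_ \<le> measure_pmf.prob _ ?E")
proof -
  let ?B = "balanced_assignments n m"
  let ?bad = "\<lambda>i. {p \<in> ?B. \<not> close (sqrt (\<epsilon> / 2)) p i}"
  \<comment> \<open>Any worker serves here: only finiteness of the sample space and the sign of the
    coherence bound are taken from this instance.\<close>
  interpret b: frame_sampling n m s 0 "n + d" u "ridge_coherence A \<gamma> * deff" deff by (rule frame_sampling[OF m_pos])
  have fin: "finite ?B" by (rule b.finite_B)
  have ne: "?B \<noteq> {}" by (rule balanced_assignments_nonempty[OF m_pos]) (simp add: n_eq)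
  then have card_pos: "0 < real (card ?B)" using fin by (simp add: card_gt_0_iff)
  have bad: "real (card (?bad i)) \<le> \<delta> / real m * real (card ?B)" if i: "i < m" for i
  proof (cases "m = 1")
    case True
    then have "?bad i = {}" using close_single_worker[OF _ True i] \<epsilon> by auto
    then show ?thesis using \<delta> by (simp only: card.empty) simp
  next
    case False
    then have "2 \<le> m" using m_pos by simp
    obtain Q where Q: "1 \<le> Q" "ln (real m * deff / \<delta>) \<le> real Q" "120 * (ridge_coherence A \<gamma> * deff / \<epsilon>) * real Q \<le> real s"
      by (rule exists_exponent[OF _ deff_nonneg \<open>2 \<le> m\<close> \<delta> s s']) (use b.R_nonneg \<epsilon> in auto)
    have "exp (- real Q) * deff \<le> \<delta> / real m"
    \<comment> \<open>For \<open>deff = 0\<close> the logarithm carries no information, but the left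
      side is zero.\<close>
    proof (cases "deff = 0")
      case False
      then have pos: "0 < real m * deff / \<delta>" using deff_nonneg m_pos \<delta> by simp
      then have "real m * deff / \<delta> \<le> exp (real Q)" using Q(2) by (metis exp_le_cancel_iff exp_ln)
      then show ?thesis using \<delta> m_pos by (simp add: exp_minus field_simps)
    qed (use \<delta> in simp)
    then have "exp (- real Q) * deff * real (card ?B) \<le> \<delta> / real m * real (card ?B)" by (rule mult_right_mono) simp
    then show ?thesis using card_not_close_le[OF i \<epsilon>(1) _ Q(1,3)] \<epsilon>(2) by simp
  qed
  \<comment> \<open>Closeness of all workers settles every \<open>t\<close> at once, so the union
    bound runs over the workers and not over the iterations.\<close>
  have "?B - ?E \<subseteq> (\<Union>i<m. ?bad i)"
    using giant_convergence[OF _ _ \<epsilon> \<open>0 < d\<close> w0 star grad] by blast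
  then have "card (?B - ?E) \<le> card (\<Union>i<m. ?bad i)" using fin by (intro card_mono) auto
  also have "\<dots> \<le> (\<Sum>i<m. card (?bad i))" by (rule card_UN_le) simp
  finally have "real (card (?B - ?E)) \<le> (\<Sum>i<m. real (card (?bad i)))" by (simp flip: of_nat_sum)
  also have "\<dots> \<le> (\<Sum>i<m. \<delta> / real m * real (card ?B))" using bad by (intro sum_mono) auto
  also have "\<dots> = \<delta> * real (card ?B)" using m_pos by simp
  finally have "(1 - \<delta>) * real (card ?B) \<le> real (card ?B) - real (card (?B - ?E))" by (simp add: algebra_simps)
  also have "\<dots> = real (card (?B \<inter> ?E))"
    using card_Diff_subset_Int[of ?B ?E] card_mono[of ?B "?B \<inter> ?E"] fin by (simp add: of_nat_diff)
  finally show ?thesis unfolding measure_pmf_of_set[OF ne fin] using card_pos by (simp add: pos_le_divide_eq)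
qed

end

theorem theorem4:
  shows "\<exists>C::real. C > 0 \<and>
    (\<forall>(n::nat) (d::nat) (m::nat) (x :: nat \<Rightarrow> real vec) (l :: nat \<Rightarrow> real \<Rightarrow> real)
       (\<gamma>::real) (\<epsilon>::real) (\<delta>::real) (w0 :: real vec) (wstar :: real vec).
       let s = n div m;
           F = objective n x l \<gamma>;
           A = data_matrix n d x l;
           H = regularized_gram A \<gamma>;
           deff = effective_dim A \<gamma>;
           \<mu> = ridge_coherence A \<gamma>;
           \<kappa> = sigma_max H / sigma_min H
       in
         0 < n \<longrightarrow> 0 < d \<longrightarrow> 0 < m \<longrightarrow> m dvd n \<longrightarrow>
         (\<forall>j<n. x j \<in> carrier_vec d) \<longrightarrow>
         (\<forall>j<n. convex_quadratic (l j)) \<longrightarrow>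
         0 < \<gamma> \<longrightarrow>
         0 < \<epsilon> \<longrightarrow> \<epsilon> < 1 / 4 \<longrightarrow> 0 < \<delta> \<longrightarrow> \<delta> < 1 \<longrightarrow>
         w0 \<in> carrier_vec d \<longrightarrow>
         is_arg_min F (\<lambda>w. w \<in> carrier_vec d) wstar \<longrightarrow>
         real s \<ge> C * (\<mu> * deff / \<epsilon>) * ln (real m * deff / \<delta>) \<longrightarrow>
         (deff < 1 \<longrightarrow> real s \<ge> C * (\<mu> * deff / \<epsilon>)) \<longrightarrow>
         measure_pmf.prob (pmf_of_set (balanced_assignments n m))
           {p. \<forall>t. vnorm (giant_iterate d m F A \<gamma> p w0 t - wstar)
                     \<le> \<epsilon> ^ t * sqrt \<kappa> * vnorm (w0 - wstar)} \<ge> 1 - \<delta>)"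
\<comment> \<open>\<open>card_not_close_le\<close> asks for the factor \<open>120\<close>, and the
  rounding in \<open>exists_exponent\<close> costs another factor \<open>3\<close>.\<close>
proof (intro exI[of _ 360] conjI allI)
  show "0 < (360 :: real)" by simp
  fix n d m :: nat and x :: "nat \<Rightarrow> real vec" and l :: "nat \<Rightarrow> real \<Rightarrow> real"
    and \<gamma> \<epsilon> \<delta> :: real and w0 wstar :: "real vec"
  show "let s = n div m;
           F = objective n x l \<gamma>;
           A = data_matrix n d x l;
           H = regularized_gram A \<gamma>;
           deff = effective_dim A \<gamma>;
           \<mu> = ridge_coherence A \<gamma>;
           \<kappa> = sigma_max H / sigma_min H
       in
         0 < n \<longrightarrow> 0 < d \<longrightarrow> 0 < m \<longrightarrow> m dvd n \<longrightarrow>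
         (\<forall>j<n. x j \<in> carrier_vec d) \<longrightarrow>
         (\<forall>j<n. convex_quadratic (l j)) \<longrightarrow>
         0 < \<gamma> \<longrightarrow>
         0 < \<epsilon> \<longrightarrow> \<epsilon> < 1 / 4 \<longrightarrow> 0 < \<delta> \<longrightarrow> \<delta> < 1 \<longrightarrow>
         w0 \<in> carrier_vec d \<longrightarrow>
         is_arg_min F (\<lambda>w. w \<in> carrier_vec d) wstar \<longrightarrow>
         real s \<ge> 360 * (\<mu> * deff / \<epsilon>) * ln (real m * deff / \<delta>) \<longrightarrow>
         (deff < 1 \<longrightarrow> real s \<ge> 360 * (\<mu> * deff / \<epsilon>)) \<longrightarrow>
         measure_pmf.prob (pmf_of_set (balanced_assignments n m))
           {p. \<forall>t. vnorm (giant_iterate d m F A \<gamma> p w0 t - wstar)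
                     \<le> \<epsilon> ^ t * sqrt \<kappa> * vnorm (w0 - wstar)} \<ge> 1 - \<delta>"
    unfolding Let_def
  proof (intro impI)
    assume n: "0 < n" and "0 < d" and m: "0 < m" "m dvd n"
      and x: "\<forall>j<n. x j \<in> carrier_vec d" and l: "\<forall>j<n. convex_quadratic (l j)"
      and \<gamma>: "0 < \<gamma>" and \<epsilon>: "0 < \<epsilon>" "\<epsilon> < 1 / 4" and \<delta>: "0 < \<delta>" "\<delta> < 1" and w0: "w0 \<in> carrier_vec d"
      and min: "is_arg_min (objective n x l \<gamma>) (\<lambda>w. w \<in> carrier_vec d) wstar"
      and s: "360 * (ridge_coherence (data_matrix n d x l) \<gamma> * effective_dim (data_matrix n d x l) \<gamma> / \<epsilon>)
        * ln (real m * effective_dim (data_matrix n d x l) \<gamma> / \<delta>) \<le> real (n div m)"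
      and s': "effective_dim (data_matrix n d x l) \<gamma> < 1 \<longrightarrow>
        360 * (ridge_coherence (data_matrix n d x l) \<gamma> * effective_dim (data_matrix n d x l) \<gamma> / \<epsilon>) \<le> real (n div m)"
    have "data_matrix n d x l \<in> carrier_mat n d" unfolding data_matrix_def by simp
    then interpret ridge_regression n d m "n div m" "data_matrix n d x l" \<gamma>
      by unfold_locales (use n m \<gamma> in \<open>auto simp: dvd_imp_le\<close>)
    have star: "wstar \<in> carrier_vec d" using min unfolding is_arg_min_def by blast
    have "gradient d (objective n x l \<gamma>) w = H *\<^sub>v (w - wstar)" if "w \<in> carrier_vec d" for w
      using gradient_objective[OF _ _ min that] x l by blast
    then show "1 - \<delta> \<le> measure_pmf.prob (pmf_of_set (balanced_assignments n m))
           {p. \<forall>t. vnorm (giant_iterate d m (objective n x l \<gamma>) (data_matrix n d x l) \<gamma> p w0 t - wstar)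
                     \<le> \<epsilon> ^ t * sqrt (sigma_max H / sigma_min H) * vnorm (w0 - wstar)}"
      using giant_probability[OF \<epsilon> \<delta> \<open>0 < d\<close> w0 star _ s] s' by blast
  qed
qed

end
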